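(* Let $\mu=\{\mu_n\}_{n\ge 0}$ and $\nu=\{\nu_n\}_{n\ge 0}$ be sequences of non-zero complex numbers such that the functions $$e_n(z)=\mu_nz^n+\nu_nz^{n+1}\qquad(z\in\mathbb{D},\ n\ge 0)$$ form an orthonormal basis of a reproducing kernel Hilbert space $\mathcal{H}_{\mu,\nu}$ of analytic functions on $\mathbb{D}$, with reproducing kernel $k_{\mu,\nu}(z,w)=\sum_{n\ge 0}e_n(z)\overline{e_n(w)}$. Assume that $$\sup_{n\ge 0}\left|\frac{\mu_n}{\mu_{n+1}}\right|<\infty\qquad\text{and}\qquad\sup_{n\ge 0}\left|\frac{\nu_n}{\mu_{n+1}}\right|<1.$$ Then: (i) $M_z^*$ on $\mathcal{H}_{\mu,\nu}$ is hypercyclic if and only if $$\liminf_n\frac{1}{(n!)^2}\frac{\partial^{2n}k_{\mu,\nu}}{\partial z^n\partial\bar{w}^n}(0,0)=0;$$ (ii) $M_z^*$ on $\mathcal{H}_{\mu,\nu}$ is topologically mixing if and only if $$\lim_n\frac{1}{(n!)^2}\frac{\partial^{2n}k_{\mu,\nu}}{\partial z^n\partial\bar{w}^n}(0,0)=0.$$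
   Context: $\mathbb{D}$ is the open unit disc in $\mathbb{C}$. The space $\mathcal{H}_{\mu,\nu}$ is called a tridiagonal space; its kernel is $$k_{\mu,\nu}(z,w)=|\mu_0|^2+\sum_{n\ge 1}(|\mu_n|^2+|\nu_{n-1}|^2)z^n\bar{w}^n+\sum_{n\ge 0}\mu_n\overline{\nu_n}z^n\bar{w}^{n+1}+\sum_{n\ge 0}\overline{\mu_n}\nu_nz^{n+1}\bar{w}^n .$$ $M_z$ is the multiplication operator $(M_zf)(w)=wf(w)$ on $\mathcal{H}_{\mu,\nu}$, which under the two displayed supremum conditions on $\mu,\nu$ is a bounded operator on $\mathcal{H}_{\mu,\nu}$ (Adams–McGuire); $M_z^*$ is its adjoint. A bounded linear operator $T$ on a Banach space $X$ is hypercyclic if there is $x\in X$ with $\{x,Tx,T^2x,\dots\}$ dense in $X$; it is topologically mixing if for any two non-empty open sets $U,V\subseteq X$ there is $N\in\mathbb{N}$ with $T^{-j}(U)\cap V\neq\emptyset$ for all $j\ge N$. *)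

theory Defs
  imports "HOL-Analysis.Analysis" "HOL-Library.Function_Algebras"
begin

text \<open>
  The pointwise complex vector space of complex-valued functions. It provides
  \<open>cfun.subspace\<close> and \<open>cfun.span\<close>.
\<close>

definition cfun_scale :: "complex \<Rightarrow> ('a \<Rightarrow> complex) \<Rightarrow> 'a \<Rightarrow> complex" where
  "cfun_scale c f = (\<lambda>x. c * f x)"

interpretation cfun: vector_space "cfun_scale :: complex \<Rightarrow> ('a \<Rightarrow> complex) \<Rightarrow> 'a \<Rightarrow> complex"
  by unfold_locales (auto simp: cfun_scale_def fun_eq_iff algebra_simps)


section \<open>Hilbert spaces of functions\<close>

definition ip_norm :: "(('a \<Rightarrow> complex) \<Rightarrow> ('a \<Rightarrow> complex) \<Rightarrow> complex) \<Rightarrow> ('a \<Rightarrow> complex) \<Rightarrow> real" where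
  "ip_norm ip f = sqrt (Re (ip f f))"

text \<open>
  The value outside \<open>H\<close> is immaterial; it is set to \<open>0\<close> because the library locale
  \<open>Metric_space\<close> asks for non-negativity and symmetry on the whole type.
\<close>

definition ip_dist ::
  "('a \<Rightarrow> complex) set \<Rightarrow> (('a \<Rightarrow> complex) \<Rightarrow> ('a \<Rightarrow> complex) \<Rightarrow> complex) \<Rightarrow>
    ('a \<Rightarrow> complex) \<Rightarrow> ('a \<Rightarrow> complex) \<Rightarrow> real" where
  "ip_dist H ip f g = (if f \<in> H \<and> g \<in> H then ip_norm ip (f - g) else 0)"

abbreviation ip_topology ::
  "('a \<Rightarrow> complex) set \<Rightarrow> (('a \<Rightarrow> complex) \<Rightarrow> ('a \<Rightarrow> complex) \<Rightarrow> complex) \<Rightarrow>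
    ('a \<Rightarrow> complex) topology" where
  "ip_topology H ip \<equiv> Metric_space.mtopology H (ip_dist H ip)"

locale inner_product_fun_space =
  fixes H :: "('a \<Rightarrow> complex) set"
    and ip :: "('a \<Rightarrow> complex) \<Rightarrow> ('a \<Rightarrow> complex) \<Rightarrow> complex"
  assumes subspace: "cfun.subspace H"
    and ip_add: "\<lbrakk>f \<in> H; g \<in> H; h \<in> H\<rbrakk> \<Longrightarrow> ip (f + g) h = ip f h + ip g h"
    and ip_scale: "\<lbrakk>f \<in> H; h \<in> H\<rbrakk> \<Longrightarrow> ip (cfun_scale c f) h = c * ip f h"
    and ip_cnj: "\<lbrakk>f \<in> H; g \<in> H\<rbrakk> \<Longrightarrow> ip g f = cnj (ip f g)"
    and ip_pos: "\<lbrakk>f \<in> H; f \<noteq> 0\<rbrakk> \<Longrightarrow> Re (ip f f) > 0"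
begin

lemma ip_zero: "h \<in> H \<Longrightarrow> ip 0 h = 0"
  using ip_add[of 0 0 h] cfun.subspace_0[OF subspace] by simp

lemma ip_nonneg: "f \<in> H \<Longrightarrow> Re (ip f f) \<ge> 0"
  using ip_pos[of f] ip_zero[of f] by (cases "f = 0") auto

lemma ip_norm_nonneg: "f \<in> H \<Longrightarrow> ip_norm ip f \<ge> 0"
  by (simp add: ip_norm_def ip_nonneg)

lemma ip_norm_eq_0: "f \<in> H \<Longrightarrow> ip_norm ip f = 0 \<longleftrightarrow> f = 0"
  using ip_pos[of f] ip_zero[of f] by (cases "f = 0") (auto simp: ip_norm_def)

lemma Re_ip_sym: "\<lbrakk>f \<in> H; g \<in> H\<rbrakk> \<Longrightarrow> Re (ip g f) = Re (ip f g)"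
  by (simp add: ip_cnj[of f g])

lemma Re_ip_expand:
  assumes "f \<in> H" "g \<in> H"
  shows "Re (ip (f + cfun_scale (of_real t) g) (f + cfun_scale (of_real t) g)) =
    Re (ip f f) + 2 * t * Re (ip f g) + t\<^sup>2 * Re (ip g g)"
proof -
  have sg: "cfun_scale (of_real t) g \<in> H"
    using assms subspace by (simp add: cfun.subspace_scale)
  have fg: "f + cfun_scale (of_real t) g \<in> H"
    using assms sg subspace by (simp add: cfun.subspace_add)
  have r: "Re (ip h (f + cfun_scale (of_real t) g)) = Re (ip f h) + t * Re (ip g h)"
    if "h \<in> H" for h
  proof -
    have "ip (f + cfun_scale (of_real t) g) h = ip f h + of_real t * ip g h"
      using assms sg that by (simp only: ip_add ip_scale)
    then show ?thesis
      unfolding ip_cnj[OF fg that] by (simp only: cnj.sel plus_complex.sel Re_complex_of_real times_complex.sel Im_complex_of_real)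
  qed
  have "ip (f + cfun_scale (of_real t) g) (f + cfun_scale (of_real t) g) =
    ip f (f + cfun_scale (of_real t) g) + of_real t * ip g (f + cfun_scale (of_real t) g)"
    using assms sg fg by (simp add: ip_add ip_scale)
  then show ?thesis
    using assms by (simp add: r Re_ip_sym[of f g] power2_eq_square algebra_simps)
qed

lemma Re_ip_le:
  assumes "f \<in> H" "g \<in> H"
  shows "Re (ip f g) \<le> ip_norm ip f * ip_norm ip g"
proof (cases "g = 0")
  case True
  then show ?thesis
    using ip_zero[OF assms(1)] ip_cnj[of g f] assms ip_norm_eq_0[of g] by simp
next
  case False
  define a b c where "a = Re (ip f f)" and "b = Re (ip f g)" and "c = Re (ip g g)"
  have c: "c > 0" using ip_pos[OF assms(2) False] by (simp add: c_def)
  have "f + cfun_scale (of_real (- b / c)) g \<in> H"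
    by (intro cfun.subspace_add[OF subspace] cfun.subspace_scale[OF subspace] assms)
  then have "0 \<le> a + 2 * (- b / c) * b + (- b / c)\<^sup>2 * c"
    using ip_nonneg Re_ip_expand[OF assms, of "- b / c"] unfolding a_def b_def c_def by metis
  also have "\<dots> = a - b\<^sup>2 / c"
    using c by (simp add: field_simps power2_eq_square)
  finally have "b\<^sup>2 \<le> a * c"
    using c by (simp add: field_simps)
  then have "b \<le> sqrt (a * c)" by (rule real_le_rsqrt)
  then show ?thesis by (simp add: ip_norm_def a_def b_def c_def real_sqrt_mult)
qed

lemma ip_norm_triangle:
  assumes "f \<in> H" "g \<in> H"
  shows "ip_norm ip (f + g) \<le> ip_norm ip f + ip_norm ip g"
proof -
  have "Re (ip (f + g) (f + g)) = Re (ip f f) + 2 * Re (ip f g) + Re (ip g g)"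
    using Re_ip_expand[OF assms, of 1] by simp
  also have "\<dots> \<le> (ip_norm ip f)\<^sup>2 + 2 * (ip_norm ip f * ip_norm ip g) + (ip_norm ip g)\<^sup>2"
    using Re_ip_le[OF assms] assms by (simp add: ip_norm_def ip_nonneg)
  also have "\<dots> = (ip_norm ip f + ip_norm ip g)\<^sup>2"
    by (simp add: power2_eq_square algebra_simps)
  finally show ?thesis
    unfolding ip_norm_def[of ip "f + g"]
    using ip_norm_nonneg assms by (intro real_le_lsqrt) auto
qed

lemma ip_norm_minus:
  assumes "f \<in> H"
  shows "ip_norm ip (- f) = ip_norm ip f"
proof -
  have "- f = 0 + cfun_scale (of_real (- 1)) f"
    by (simp add: cfun_scale_def fun_eq_iff)
  then have "Re (ip (- f) (- f)) = Re (ip f f)"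
    using Re_ip_expand[of 0 f "- 1"] assms cfun.subspace_0[OF subspace] ip_zero by simp
  then show ?thesis by (simp add: ip_norm_def)
qed

sublocale Metric_space H "ip_dist H ip"
proof
  fix f g h
  show "0 \<le> ip_dist H ip f g"
    by (simp add: ip_dist_def ip_norm_nonneg cfun.subspace_diff[OF subspace])
  show "ip_dist H ip f g = ip_dist H ip g f"
    using ip_norm_minus[of "f - g"] by (auto simp: ip_dist_def cfun.subspace_diff[OF subspace])
  show "ip_dist H ip f g = 0 \<longleftrightarrow> f = g" if "f \<in> H" "g \<in> H"
    using that by (simp add: ip_dist_def ip_norm_eq_0 cfun.subspace_diff[OF subspace])
  show "ip_dist H ip f h \<le> ip_dist H ip f g + ip_dist H ip g h" if "f \<in> H" "g \<in> H" "h \<in> H"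
    using that ip_norm_triangle[of "f - g" "g - h"]
    by (simp add: ip_dist_def cfun.subspace_diff[OF subspace])
qed

end

text \<open>
  Functions on \<open>X\<close> are represented by functions on the whole type that vanish outside \<open>X\<close>,
  so that equality of functions is equality on \<open>X\<close>.
\<close>

locale rkhs = inner_product_fun_space H ip
  for X :: "'a set" and H and ip :: "('a \<Rightarrow> complex) \<Rightarrow> ('a \<Rightarrow> complex) \<Rightarrow> complex" +
  assumes complete: "Metric_space.mcomplete H (ip_dist H ip)"
    and vanishes: "\<lbrakk>f \<in> H; x \<notin> X\<rbrakk> \<Longrightarrow> f x = 0"
    and eval_bounded: "x \<in> X \<Longrightarrow> \<exists>C. \<forall>f\<in>H. cmod (f x) \<le> C * ip_norm ip f"

definition is_reproducing_kernel ::
  "'a set \<Rightarrow> ('a \<Rightarrow> complex) set \<Rightarrow> (('a \<Rightarrow> complex) \<Rightarrow> ('a \<Rightarrow> complex) \<Rightarrow> complex) \<Rightarrow>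
    ('a \<Rightarrow> 'a \<Rightarrow> complex) \<Rightarrow> bool" where
  "is_reproducing_kernel X H ip k \<longleftrightarrow>
    (\<forall>w\<in>X. (\<lambda>z. k z w) \<in> H \<and> (\<forall>f\<in>H. f w = ip f (\<lambda>z. k z w)))"

definition is_orthonormal_basis ::
  "('a \<Rightarrow> complex) set \<Rightarrow> (('a \<Rightarrow> complex) \<Rightarrow> ('a \<Rightarrow> complex) \<Rightarrow> complex) \<Rightarrow>
    (nat \<Rightarrow> 'a \<Rightarrow> complex) \<Rightarrow> bool" where
  "is_orthonormal_basis H ip e \<longleftrightarrow>
    range e \<subseteq> H \<and>
    (\<forall>m n. ip (e m) (e n) = (if m = n then 1 else 0)) \<and>
    ip_topology H ip closure_of (cfun.span (range e)) = H"


section \<open>Operators and their dynamics\<close>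

definition bounded_operator_on ::
  "('a \<Rightarrow> complex) set \<Rightarrow> (('a \<Rightarrow> complex) \<Rightarrow> ('a \<Rightarrow> complex) \<Rightarrow> complex) \<Rightarrow>
    (('a \<Rightarrow> complex) \<Rightarrow> ('a \<Rightarrow> complex)) \<Rightarrow> bool" where
  "bounded_operator_on H ip T \<longleftrightarrow>
    (\<forall>f\<in>H. T f \<in> H) \<and>
    (\<forall>f\<in>H. \<forall>g\<in>H. T (f + g) = T f + T g) \<and>
    (\<forall>c. \<forall>f\<in>H. T (cfun_scale c f) = cfun_scale c (T f)) \<and>
    (\<exists>C. \<forall>f\<in>H. ip_norm ip (T f) \<le> C * ip_norm ip f)"

text \<open>
  For a bounded operator on a Hilbert space the described element exists and is unique.
\<close>

definition adjoint_on ::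
  "('a \<Rightarrow> complex) set \<Rightarrow> (('a \<Rightarrow> complex) \<Rightarrow> ('a \<Rightarrow> complex) \<Rightarrow> complex) \<Rightarrow>
    (('a \<Rightarrow> complex) \<Rightarrow> ('a \<Rightarrow> complex)) \<Rightarrow> ('a \<Rightarrow> complex) \<Rightarrow> ('a \<Rightarrow> complex)" where
  "adjoint_on H ip T g = (THE h. h \<in> H \<and> (\<forall>f\<in>H. ip (T f) g = ip f h))"

definition hypercyclic_on ::
  "('a \<Rightarrow> complex) set \<Rightarrow> (('a \<Rightarrow> complex) \<Rightarrow> ('a \<Rightarrow> complex) \<Rightarrow> complex) \<Rightarrow>
    (('a \<Rightarrow> complex) \<Rightarrow> ('a \<Rightarrow> complex)) \<Rightarrow> bool" where
  "hypercyclic_on H ip T \<longleftrightarrow>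
    bounded_operator_on H ip T \<and>
    (\<exists>f\<in>H. ip_topology H ip closure_of (range (\<lambda>n. (T ^^ n) f)) = H)"

definition topologically_mixing_on ::
  "('a \<Rightarrow> complex) set \<Rightarrow> (('a \<Rightarrow> complex) \<Rightarrow> ('a \<Rightarrow> complex) \<Rightarrow> complex) \<Rightarrow>
    (('a \<Rightarrow> complex) \<Rightarrow> ('a \<Rightarrow> complex)) \<Rightarrow> bool" where
  "topologically_mixing_on H ip T \<longleftrightarrow>
    bounded_operator_on H ip T \<and>
    (\<forall>U V. openin (ip_topology H ip) U \<and> U \<noteq> {} \<and> openin (ip_topology H ip) V \<and> V \<noteq> {} \<longrightarrow>
      (\<exists>N. \<forall>j\<ge>N. {f \<in> H. (T ^^ j) f \<in> U} \<inter> V \<noteq> {}))"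


section \<open>Wirtinger derivatives\<close>

definition wirtinger_z :: "(complex \<Rightarrow> complex) \<Rightarrow> complex \<Rightarrow> complex" where
  "wirtinger_z f z =
    (frechet_derivative f (at z) 1 - \<i> * frechet_derivative f (at z) \<i>) / 2"

definition wirtinger_zbar :: "(complex \<Rightarrow> complex) \<Rightarrow> complex \<Rightarrow> complex" where
  "wirtinger_zbar f z =
    (frechet_derivative f (at z) 1 + \<i> * frechet_derivative f (at z) \<i>) / 2"

text \<open>\<open>m\<close> derivatives in \<open>z\<close> and \<open>n\<close> derivatives in the conjugate of \<open>w\<close>.\<close>

definition mixed_wirtinger ::
  "nat \<Rightarrow> nat \<Rightarrow> (complex \<Rightarrow> complex \<Rightarrow> complex) \<Rightarrow> complex \<Rightarrow> complex \<Rightarrow> complex" where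
  "mixed_wirtinger m n k z w = (wirtinger_z ^^ m) (\<lambda>u. (wirtinger_zbar ^^ n) (k u) w) z"


section \<open>Tridiagonal spaces\<close>

definition tridiag_basis :: "(nat \<Rightarrow> complex) \<Rightarrow> (nat \<Rightarrow> complex) \<Rightarrow> nat \<Rightarrow> complex \<Rightarrow> complex" where
  "tridiag_basis \<mu> \<nu> n z = (if z \<in> ball 0 1 then \<mu> n * z ^ n + \<nu> n * z ^ Suc n else 0)"

definition tridiag_kernel :: "(nat \<Rightarrow> complex) \<Rightarrow> (nat \<Rightarrow> complex) \<Rightarrow> complex \<Rightarrow> complex \<Rightarrow> complex" where
  "tridiag_kernel \<mu> \<nu> z w = (\<Sum>n. tridiag_basis \<mu> \<nu> n z * cnj (tridiag_basis \<mu> \<nu> n w))"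

locale tridiagonal_space = rkhs "ball 0 1" H ip
  for \<mu> \<nu> :: "nat \<Rightarrow> complex"
    and H :: "(complex \<Rightarrow> complex) set"
    and ip :: "(complex \<Rightarrow> complex) \<Rightarrow> (complex \<Rightarrow> complex) \<Rightarrow> complex" +
  assumes analytic: "f \<in> H \<Longrightarrow> f analytic_on ball 0 1"
    and orthonormal_basis: "is_orthonormal_basis H ip (tridiag_basis \<mu> \<nu>)"
    and kernel_summable: "\<lbrakk>z \<in> ball 0 1; w \<in> ball 0 1\<rbrakk> \<Longrightarrow>
      summable (\<lambda>n. tridiag_basis \<mu> \<nu> n z * cnj (tridiag_basis \<mu> \<nu> n w))"
    and reproducing_kernel: "is_reproducing_kernel (ball 0 1) H ip (tridiag_kernel \<mu> \<nu>)"

definition mult_z :: "(complex \<Rightarrow> complex) \<Rightarrow> complex \<Rightarrow> complex" where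
  "mult_z f = (\<lambda>w. w * f w)"

end

theory Submission
  imports Defs "HOL-Complex_Analysis.Complex_Analysis"
begin

text \<open>
  Put \<open>p n\<close> for the function \<open>z ^ n\<close> on the disc. Since \<open>\<nu> n / \<mu> (Suc n)\<close> is bounded by some
  \<open>r < 1\<close>, the orthonormal basis is \<open>(1 + W)\<close> applied to the vectors \<open>\<mu> n p n\<close>, with \<open>W\<close> a weighted
  shift of norm at most \<open>r\<close>; hence these vectors form a Riesz basis. In the coordinates
  \<open>n \<mapsto> ip g (p n)\<close> the space becomes a weighted \<open>\<ell>\<^sup>2\<close> with weights \<open>cmod (\<mu> n)\<close> (up to
  equivalence of norms) and the adjoint of multiplication by \<open>z\<close> becomes the unweighted backward
  shift. As for Salas' theorem, the shift is hypercyclic iff the weights have lower limit \<open>0\<close>, and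
  mixing iff they tend to \<open>0\<close>. The \<open>n\<close>-th diagonal Taylor coefficient of the kernel is
  \<open>(cmod (\<mu> n))\<^sup>2 + (cmod (\<nu> (n - 1)))\<^sup>2\<close>, which lies between \<open>(cmod (\<mu> n))\<^sup>2\<close> and twice that.
\<close>

section \<open>Bounds in sequence space and orthonormal expansions\<close>

text \<open>In the basis itself, multiplication by z generally sends a basis vector to an infinite
  combination; pairing with monomials removes this at the price of a norm equivalence. Neither
  \<open>W\<close> nor an inverse of \<open>1 + W\<close> is built as an operator: two scalar
  recursions do their work. Passing from Taylor coefficients to basis coefficients is a forward
  recursion; it has a starting value, and \<open>r < 1\<close> alone controls its solution. Passing
  from basis coefficients to the pairings with monomials is a backward recursion; it has no starting
  value, and its homogeneous solutions may grow geometrically. An a priori bound must exclude them,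
  and it comes from a norm estimate for the monomials, itself a product of the forward recursion.
  The bound on the quotients of consecutive \<mu>'s acts twice: it makes the shift bounded, and it
  spreads one small weight over a window of preceding indices, which a vanishing lower limit does
  not give by itself. Square-summability is phrased through finite sections, whose norms are finite
  beforehand, so that they can be absorbed in the recursive estimates.\<close>

definition l2_bound :: "(nat \<Rightarrow> complex) \<Rightarrow> real \<Rightarrow> bool" where
  "l2_bound x B \<longleftrightarrow> (\<forall>N. L2_set (\<lambda>n. cmod (x n)) {..<N} \<le> B)"

lemma l2_bound_D: "l2_bound x B \<Longrightarrow> L2_set (\<lambda>n. cmod (x n)) {..<N} \<le> B"
  by (simp add: l2_bound_def)

lemma l2_bound_nonneg: "l2_bound x B \<Longrightarrow> B \<ge> 0"
  using l2_bound_D[of x B 0] by simp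

lemma l2_bound_mono: "l2_bound x A \<Longrightarrow> A \<le> B \<Longrightarrow> l2_bound x B"
  unfolding l2_bound_def by (meson order_trans)

lemma l2_bound_add:
  assumes "l2_bound x A" "l2_bound y B"
  shows "l2_bound (\<lambda>n. x n + y n) (A + B)"
  unfolding l2_bound_def
proof
  fix N
  have "L2_set (\<lambda>n. cmod (x n + y n)) {..<N} \<le> L2_set (\<lambda>n. cmod (x n) + cmod (y n)) {..<N}"
    by (intro L2_set_mono norm_triangle_ineq) auto
  also have "\<dots> \<le> L2_set (\<lambda>n. cmod (x n)) {..<N} + L2_set (\<lambda>n. cmod (y n)) {..<N}"
    by (rule L2_set_triangle_ineq)
  also have "\<dots> \<le> A + B"
    using assms by (intro add_mono l2_bound_D)
  finally show "L2_set (\<lambda>n. cmod (x n + y n)) {..<N} \<le> A + B" .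
qed

lemma l2_bound_le_mult:
  assumes "l2_bound x A" "\<And>n. cmod (y n) \<le> r * cmod (x n)" "r \<ge> 0"
  shows "l2_bound y (r * A)"
  unfolding l2_bound_def
proof
  fix N
  have "L2_set (\<lambda>n. cmod (y n)) {..<N} \<le> L2_set (\<lambda>n. r * cmod (x n)) {..<N}"
    by (intro L2_set_mono assms) auto
  also have "\<dots> = r * L2_set (\<lambda>n. cmod (x n)) {..<N}"
    using assms by (simp add: L2_set_right_distrib)
  also have "\<dots> \<le> r * A"
    using assms by (intro mult_left_mono l2_bound_D)
  finally show "L2_set (\<lambda>n. cmod (y n)) {..<N} \<le> r * A" .
qed

lemma l2_bound_mult:
  assumes "l2_bound x A" "\<And>n. cmod (m n) \<le> r" "r \<ge> 0"
  shows "l2_bound (\<lambda>n. m n * x n) (r * A)"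
  using assms by (intro l2_bound_le_mult[of x A]) (auto simp: norm_mult intro: mult_right_mono)

lemma l2_bound_component: "l2_bound x B \<Longrightarrow> cmod (x n) \<le> B"
  using member_le_L2_set[of "{..<Suc n}" n "\<lambda>n. cmod (x n)"] l2_bound_D[of x B "Suc n"]
  by simp

lemma L2_set_lessThan_Suc_shift:
  "L2_set f {..<Suc N} = sqrt ((f 0)\<^sup>2 + (L2_set (\<lambda>n. f (Suc n)) {..<N})\<^sup>2)"
  by (simp add: L2_set_def sum.lessThan_Suc_shift sum_nonneg del: sum.lessThan_Suc)

lemma l2_bound_shift:
  assumes "l2_bound x A"
  shows "l2_bound (\<lambda>n. x (Suc n)) A"
  unfolding l2_bound_def
proof
  fix N
  have "L2_set (\<lambda>n. cmod (x (Suc n))) {..<N} \<le> L2_set (\<lambda>n. cmod (x n)) {..<Suc N}"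
    unfolding L2_set_lessThan_Suc_shift by (intro real_le_rsqrt) auto
  then show "L2_set (\<lambda>n. cmod (x (Suc n))) {..<N} \<le> A"
    using l2_bound_D[OF assms, of "Suc N"] by linarith
qed

lemma l2_bound_unshift:
  assumes "l2_bound x A"
  shows "l2_bound (case_nat 0 x) A"
  unfolding l2_bound_def
proof
  fix N
  show "L2_set (\<lambda>n. cmod (case_nat 0 x n)) {..<N} \<le> A"
  proof (cases N)
    case 0
    then show ?thesis using l2_bound_nonneg[OF assms] by simp
  next
    case (Suc M)
    then show ?thesis
      using l2_bound_D[OF assms, of M] by (simp add: L2_set_lessThan_Suc_shift)
  qed
qed

lemma l2_bound_summable:
  assumes "l2_bound x B"
  shows "summable (\<lambda>n. (cmod (x n))\<^sup>2)"
proof (rule summableI_nonneg_bounded)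
  fix N
  have "sqrt (\<Sum>n<N. (cmod (x n))\<^sup>2) \<le> B"
    using l2_bound_D[OF assms, of N] by (simp add: L2_set_def)
  then show "(\<Sum>n<N. (cmod (x n))\<^sup>2) \<le> B\<^sup>2"
    by (simp add: sqrt_le_D)
qed auto

text \<open>Cauchy criterion for the series of squares. The first form truncates a vector, the
  second makes partial sums a Cauchy sequence.\<close>

lemma l2_bound_tail:
  assumes "l2_bound x B" "\<epsilon> > 0"
  obtains N where "l2_bound (\<lambda>n. if n < N then 0 else x n) \<epsilon>"
    and "\<And>m n. N \<le> m \<Longrightarrow> L2_set (\<lambda>n. cmod (x n)) {m..<n} < \<epsilon>"
proof -
  obtain N where N: "\<And>m n. N \<le> m \<Longrightarrow> norm (\<Sum>n=m..<n. (cmod (x n))\<^sup>2) < \<epsilon>\<^sup>2"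
    using l2_bound_summable[OF assms(1)] assms(2) unfolding summable_Cauchy
    by (meson zero_less_power)
  have *: "L2_set (\<lambda>n. cmod (x n)) {m..<n} < \<epsilon>" if "N \<le> m" for m n
  proof -
    have "sqrt (\<Sum>n=m..<n. (cmod (x n))\<^sup>2) < \<epsilon>"
      using N[OF that, of n] assms(2) by (intro real_less_lsqrt) (auto simp: sum_nonneg)
    then show ?thesis by (simp add: L2_set_def)
  qed
  have "L2_set (\<lambda>n. cmod (if n < N then 0 else x n)) {..<M} \<le> \<epsilon>" for M
  proof -
    have "(\<Sum>n<M. (cmod (if n < N then 0 else x n))\<^sup>2) = (\<Sum>n=N..<M. (cmod (x n))\<^sup>2)"
      by (rule sum.mono_neutral_cong_right) auto
    then have "L2_set (\<lambda>n. cmod (if n < N then 0 else x n)) {..<M} = L2_set (\<lambda>n. cmod (x n)) {N..<M}"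
      by (simp add: L2_set_def)
    then show ?thesis using *[of N M] by simp
  qed
  then have "l2_bound (\<lambda>n. if n < N then 0 else x n) \<epsilon>" by (simp add: l2_bound_def)
  then show thesis using * that by blast
qed

lemma l2_bound_finite_sum:
  assumes "\<And>n. n \<ge> L \<Longrightarrow> x n = 0"
  shows "l2_bound x (\<Sum>n<L. cmod (x n))"
  unfolding l2_bound_def
proof
  fix N
  have "L2_set (\<lambda>n. cmod (x n)) {..<N} \<le> (\<Sum>n<N. cmod (x n))"
    by (intro L2_set_le_sum) auto
  also have "\<dots> \<le> (\<Sum>n<max N L. cmod (x n))"
    by (intro sum_mono2) auto
  also have "\<dots> = (\<Sum>n<L. cmod (x n))"
    using assms by (intro sum.mono_neutral_right) auto
  finally show "L2_set (\<lambda>n. cmod (x n)) {..<N} \<le> (\<Sum>n<L. cmod (x n))" .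
qed

section \<open>Algebra of the inner product, Cauchy-Schwarz and density\<close>

context inner_product_fun_space
begin

lemma zero_in: "0 \<in> H"
  by (rule cfun.subspace_0[OF subspace])

lemma scale_in: "f \<in> H \<Longrightarrow> cfun_scale c f \<in> H"
  by (rule cfun.subspace_scale[OF subspace])

lemma add_in: "f \<in> H \<Longrightarrow> g \<in> H \<Longrightarrow> f + g \<in> H"
  by (rule cfun.subspace_add[OF subspace])

lemma diff_in: "f \<in> H \<Longrightarrow> g \<in> H \<Longrightarrow> f - g \<in> H"
  by (rule cfun.subspace_diff[OF subspace])

lemma sum_in: "(\<And>n. n \<in> A \<Longrightarrow> f n \<in> H) \<Longrightarrow> sum f A \<in> H"
  by (rule cfun.subspace_sum[OF subspace])

lemma ip_diff:
  assumes "f \<in> H" "g \<in> H" "h \<in> H"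
  shows "ip (f - g) h = ip f h - ip g h"
  using ip_add[of "f - g" g h] assms diff_in[of f g] by simp

lemma ip_add_right:
  assumes "f \<in> H" "g \<in> H" "h \<in> H"
  shows "ip h (f + g) = ip h f + ip h g"
  using ip_cnj[of "f + g" h] ip_cnj[of f h] ip_cnj[of g h] assms by (simp add: ip_add add_in)

lemma ip_scale_right:
  assumes "f \<in> H" "h \<in> H"
  shows "ip h (cfun_scale c f) = cnj c * ip h f"
  using ip_cnj[of "cfun_scale c f" h] ip_cnj[of f h] assms by (simp add: ip_scale scale_in)

lemma ip_sum:
  assumes "\<And>n. n \<in> A \<Longrightarrow> f n \<in> H" "h \<in> H"
  shows "ip (sum f A) h = (\<Sum>n\<in>A. ip (f n) h)"
  using assms(1)
proof (induction A rule: infinite_finite_induct)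
  case (insert x F)
  have "ip (f x + sum f F) h = ip (f x) h + ip (sum f F) h"
    by (intro ip_add sum_in assms(2) insert.prems insertI1 insertI2)
  also have "ip (sum f F) h = (\<Sum>n\<in>F. ip (f n) h)"
    by (rule insert.IH) (rule insert.prems, rule insertI2)
  finally show ?case
    unfolding sum.insert[OF insert.hyps] .
qed (use ip_zero assms(2) in auto)

lemma ip_norm_scale:
  assumes "f \<in> H"
  shows "ip_norm ip (cfun_scale c f) = cmod c * ip_norm ip f"
proof -
  have "ip (cfun_scale c f) (cfun_scale c f) = (c * cnj c) * ip f f"
    using assms by (simp add: ip_scale ip_scale_right scale_in)
  also have "\<dots> = of_real ((cmod c)\<^sup>2) * ip f f"
    by (simp only: complex_norm_square)
  finally have "Re (ip (cfun_scale c f) (cfun_scale c f)) = (cmod c)\<^sup>2 * Re (ip f f)"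
    by simp
  then show ?thesis
    by (simp add: ip_norm_def real_sqrt_mult)
qed

lemma cmod_ip_le:
  assumes "f \<in> H" "g \<in> H"
  shows "cmod (ip f g) \<le> ip_norm ip f * ip_norm ip g"
proof (cases "ip f g = 0")
  case True
  then show ?thesis using ip_norm_nonneg assms by simp
next
  case False
  \<comment> \<open>A unimodular factor turns the pairing into a nonnegative real, so the bound for
    real parts applies.\<close>
  define c where "c = cnj (ip f g) / cmod (ip f g)"
  have c: "cmod c = 1" using False by (simp add: c_def norm_divide)
  have "c * ip f g = of_real (cmod (ip f g))"
    using False by (simp add: c_def mult.commute[of "cnj _"] complex_norm_square[symmetric] power2_eq_square)
  then have "cmod (ip f g) = Re (ip (cfun_scale c f) g)"
    using assms by (simp add: ip_scale)
  also have "\<dots> \<le> ip_norm ip (cfun_scale c f) * ip_norm ip g"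
    using assms by (intro Re_ip_le scale_in)
  finally show ?thesis using assms c by (simp add: ip_norm_scale)
qed

lemma ip_norm_diff_sym: "f \<in> H \<Longrightarrow> g \<in> H \<Longrightarrow> ip_norm ip (f - g) = ip_norm ip (g - f)"
  using ip_norm_minus[of "f - g"] diff_in[of f g] by simp

lemma ip_norm_diff_triangle:
  "f \<in> H \<Longrightarrow> g \<in> H \<Longrightarrow> h \<in> H \<Longrightarrow> ip_norm ip (f - h) \<le> ip_norm ip (f - g) + ip_norm ip (g - h)"
  using ip_norm_triangle[of "f - g" "g - h"] diff_in[of f g] diff_in[of g h] by simp

lemma closure_eq_H_iff:
  "mtopology closure_of S = H \<longleftrightarrow> (\<forall>g\<in>H. \<forall>\<epsilon>>0. \<exists>f\<in>S \<inter> H. ip_norm ip (g - f) < \<epsilon>)"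
proof -
  have "mtopology closure_of S = {g \<in> H. \<forall>\<epsilon>>0. \<exists>f\<in>S \<inter> H. ip_norm ip (g - f) < \<epsilon>}"
    unfolding metric_closure_of by (auto simp: ip_dist_def in_mball)
  then show ?thesis by blast
qed

end

section \<open>Bessel, Riesz-Fischer and Fourier expansion\<close>

locale hilbert_fun_basis = inner_product_fun_space H ip
  for H :: "('a \<Rightarrow> complex) set" and ip +
  fixes e :: "nat \<Rightarrow> 'a \<Rightarrow> complex"
  assumes mcomplete: "mcomplete"
    and basis: "is_orthonormal_basis H ip e"
begin

lemma e_in: "e n \<in> H"
  using basis by (auto simp: is_orthonormal_basis_def)

lemma ip_e: "ip (e m) (e n) = (if m = n then 1 else 0)"
  using basis by (auto simp: is_orthonormal_basis_def)

lemma ip_norm_e: "ip_norm ip (e n) = 1"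
  by (simp add: ip_norm_def ip_e)

lemma dense_span:
  assumes "g \<in> H" "\<epsilon> > 0"
  obtains f where "f \<in> cfun.span (range e)" "f \<in> H" "ip_norm ip (g - f) < \<epsilon>"
proof -
  have "mtopology closure_of (cfun.span (range e)) = H"
    using basis unfolding is_orthonormal_basis_def by (elim conjE)
  then have "\<forall>g\<in>H. \<forall>\<epsilon>>0. \<exists>f\<in>cfun.span (range e) \<inter> H. ip_norm ip (g - f) < \<epsilon>"
    by (rule closure_eq_H_iff[THEN iffD1])
  from this[rule_format, OF assms] show thesis
    by (elim bexE IntE) (rule that)
qed

text \<open>Such a functional vanishes on the span, which is dense. It is stated for an arbitrary
  \<open>\<phi>\<close> because it serves both uniqueness of coefficients and the adjoint identity
  for \<open>mult_z\<close>.\<close>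

lemma bounded_functional_eq_0:
  assumes add: "\<And>f g. f \<in> H \<Longrightarrow> g \<in> H \<Longrightarrow> \<phi> (f + g) = \<phi> f + \<phi> g"
    and scale: "\<And>f c. f \<in> H \<Longrightarrow> \<phi> (cfun_scale c f) = c * \<phi> f"
    and bound: "\<And>f. f \<in> H \<Longrightarrow> cmod (\<phi> f) \<le> C * ip_norm ip f"
    and zero: "\<And>n. \<phi> (e n) = 0"
    and f: "f \<in> H"
  shows "\<phi> f = (0::complex)"
proof -
  have \<phi>0: "\<phi> 0 = 0"
  proof -
    have "cfun_scale 0 0 = (0 :: 'a \<Rightarrow> complex)" by (rule cfun.scale_zero_left)
    then show ?thesis using scale[OF zero_in, of 0] by simp
  qed
  have "cfun.subspace {f \<in> H. \<phi> f = 0}"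
  proof (rule cfun.subspaceI)
    fix g h assume "g \<in> {f \<in> H. \<phi> f = 0}" "h \<in> {f \<in> H. \<phi> f = 0}"
    then have "g \<in> H" "h \<in> H" "\<phi> g = 0" "\<phi> h = 0" by auto
    then have "g + h \<in> H" "\<phi> (g + h) = 0" using add[of g h] add_in[of g h] by (auto simp only: add_0)
    then show "g + h \<in> {f \<in> H. \<phi> f = 0}" by (intro CollectI conjI)
  next
    fix c g assume "g \<in> {f \<in> H. \<phi> f = 0}"
    then show "cfun_scale c g \<in> {f \<in> H. \<phi> f = 0}" using scale[of g c] scale_in[of g c] by auto
  qed (use zero_in \<phi>0 in auto)
  then have span: "cfun.span (range e) \<subseteq> {f \<in> H. \<phi> f = 0}"
    using e_in zero by (intro cfun.span_minimal) auto
  have "cmod (\<phi> f) \<le> 0 + \<epsilon>" if "\<epsilon> > 0" for \<epsilon>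
  proof -
    \<comment> \<open>\<open>C\<close> may be zero or negative, so it cannot serve as a
      divisor.\<close>
    have C: "\<bar>C\<bar> + 1 > 0" by simp
    obtain g where g: "g \<in> cfun.span (range e)" "ip_norm ip (f - g) < \<epsilon> / (\<bar>C\<bar> + 1)"
      using dense_span[OF f divide_pos_pos[OF \<open>\<epsilon> > 0\<close> C]] by blast
    have gH: "g \<in> H" and "\<phi> g = 0" using span g by auto
    have fg: "f - g \<in> H" using f gH by (rule diff_in)
    have "\<phi> f = \<phi> (f - g)"
      using add[OF fg gH] unfolding diff_add_cancel \<open>\<phi> g = 0\<close> add_0_right .
    also have "cmod \<dots> \<le> C * ip_norm ip (f - g)" by (rule bound[OF fg])
    also have "\<dots> \<le> (\<bar>C\<bar> + 1) * ip_norm ip (f - g)"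
      using ip_norm_nonneg[OF fg] by (intro mult_right_mono) auto
    also have "\<dots> \<le> \<epsilon>"
      using g(2) C by (simp add: field_simps)
    finally show ?thesis by simp
  qed
  then have "cmod (\<phi> f) \<le> 0" by (rule field_le_epsilon)
  then show ?thesis by simp
qed

text \<open>The functional pairing with \<open>f - g\<close> vanishes on the basis, hence
  everywhere, in particular at \<open>f - g\<close>.\<close>

lemma eqI_coeffs:
  assumes "f \<in> H" "g \<in> H" "\<And>n. ip f (e n) = ip g (e n)"
  shows "f = g"
proof -
  have d: "f - g \<in> H" using assms by (simp add: diff_in)
  have "ip h (f - g) = 0" if "h \<in> H" for h
  proof (rule bounded_functional_eq_0[where \<phi> = "\<lambda>h. ip h (f - g)" and C = "ip_norm ip (f - g)"])
    fix n
    have "ip (f - g) (e n) = 0" using assms by (simp add: ip_diff e_in)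
    then show "ip (e n) (f - g) = 0" using ip_cnj[OF d e_in] by simp
  qed (use d that in \<open>auto simp: ip_add ip_scale cmod_ip_le mult.commute[of "ip_norm ip (f - g)"]\<close>)
  then have "ip (f - g) (f - g) = 0" using d by blast
  then have "f - g = 0" using ip_pos[OF d] by force
  then show ?thesis by simp
qed

lemma partial_sum_in: "(\<Sum>n\<in>A. cfun_scale (a n) (e n)) \<in> H"
  by (simp add: sum_in scale_in e_in)

lemma ip_partial_sum:
  "finite A \<Longrightarrow> ip (\<Sum>n\<in>A. cfun_scale (a n) (e n)) (e m) = (if m \<in> A then a m else 0)"
  by (simp add: ip_sum scale_in e_in ip_scale ip_e if_distrib cong: if_cong)

lemma ip_partial_sum_right:
  assumes "finite A" "f \<in> H"
  shows "ip f (\<Sum>n\<in>A. cfun_scale (a n) (e n)) = (\<Sum>n\<in>A. cnj (a n) * ip f (e n))"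
proof -
  have "ip (\<Sum>n\<in>A. cfun_scale (a n) (e n)) f = (\<Sum>n\<in>A. a n * ip (e n) f)"
    using assms by (simp add: ip_sum scale_in e_in ip_scale)
  then show ?thesis
    using ip_cnj[OF partial_sum_in assms(2)] ip_cnj[OF e_in assms(2)] by (simp add: cnj_sum)
qed

lemma ip_norm_partial_sum:
  assumes "finite A"
  shows "ip_norm ip (\<Sum>n\<in>A. cfun_scale (a n) (e n)) = L2_set (\<lambda>n. cmod (a n)) A"
proof -
  have "ip (\<Sum>n\<in>A. cfun_scale (a n) (e n)) (\<Sum>n\<in>A. cfun_scale (a n) (e n)) =
      (\<Sum>n\<in>A. cnj (a n) * a n)"
    by (subst ip_partial_sum_right[OF assms partial_sum_in])
       (intro sum.cong refl, simp add: ip_partial_sum[OF assms])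
  also have "\<dots> = of_real (\<Sum>n\<in>A. (cmod (a n))\<^sup>2)"
    by (simp add: complex_norm_square mult.commute del: of_real_power)
  finally show ?thesis by (simp add: ip_norm_def L2_set_def)
qed

text \<open>Pairing \<open>f\<close> with its own partial sum of norm \<open>L\<close> gives
  \<open>L\<^sup>2\<close>, and Cauchy-Schwarz bounds this by
  \<open>ip_norm ip f * L\<close>.\<close>

lemma bessel:
  assumes "f \<in> H"
  shows "l2_bound (\<lambda>n. ip f (e n)) (ip_norm ip f)"
  unfolding l2_bound_def
proof
  fix N
  define s where "s = (\<Sum>n<N. cfun_scale (ip f (e n)) (e n))"
  have s: "s \<in> H" by (simp add: s_def partial_sum_in)
  define L where "L = L2_set (\<lambda>n. cmod (ip f (e n))) {..<N}"
  have "ip_norm ip s = L" by (simp add: s_def ip_norm_partial_sum L_def)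
  have "ip f s = of_real (\<Sum>n<N. (cmod (ip f (e n)))\<^sup>2)"
    unfolding s_def using assms
    by (simp add: ip_partial_sum_right complex_norm_square mult.commute del: of_real_power)
  then have "cmod (ip f s) = (\<Sum>n<N. (cmod (ip f (e n)))\<^sup>2)"
    by (simp only: norm_of_real) (simp add: sum_nonneg)
  then have "L\<^sup>2 = cmod (ip f s)"
    by (simp add: L_def L2_set_def sum_nonneg)
  also have "\<dots> \<le> ip_norm ip f * L"
    using cmod_ip_le[OF assms s] \<open>ip_norm ip s = L\<close> by simp
  finally show "L2_set (\<lambda>n. cmod (ip f (e n))) {..<N} \<le> ip_norm ip f"
    using ip_norm_nonneg[OF assms] unfolding L_def[symmetric]
    by (cases "L > 0") (auto simp: power2_eq_square L_def intro: order_trans)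
qed

text \<open>This is where completeness enters. The partial sums are Cauchy by the tail estimate, and
  pairing with a basis vector is continuous, so the limit has the right coefficients.\<close>

lemma riesz_fischer:
  assumes "l2_bound a B"
  obtains g where "g \<in> H" "\<And>n. ip g (e n) = a n" "ip_norm ip g \<le> B"
    "(\<lambda>N. ip_norm ip (g - (\<Sum>n<N. cfun_scale (a n) (e n)))) \<longlonglongrightarrow> 0"
proof -
  define s where "s N = (\<Sum>n<N. cfun_scale (a n) (e n))" for N
  have sH: "s N \<in> H" for N by (simp add: s_def partial_sum_in)
  have s_diff: "s M - s N = (\<Sum>n=N..<M. cfun_scale (a n) (e n))" if "N \<le> M" for N M
    using sum_diff_nat_ivl[of 0 N M "\<lambda>n. cfun_scale (a n) (e n)"] that
    by (simp add: s_def atLeast0LessThan)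
  have small: "\<exists>N. \<forall>m\<ge>N. \<forall>n\<ge>N. ip_norm ip (s m - s n) < \<epsilon>" if eps: "\<epsilon> > 0" for \<epsilon>
  proof -
    obtain N where N: "\<And>m n. N \<le> m \<Longrightarrow> L2_set (\<lambda>n. cmod (a n)) {m..<n} < \<epsilon>"
      using l2_bound_tail[OF assms eps] by metis
    have 1: "ip_norm ip (s m - s n) < \<epsilon>" if "N \<le> n" "n \<le> m" for m n
      using that N[of n m] by (simp add: s_diff ip_norm_partial_sum)
    have "ip_norm ip (s m - s n) < \<epsilon>" if "N \<le> n" "N \<le> m" for m n
      using 1[of n m] 1[of m n] that ip_norm_diff_sym[OF sH sH, of m n] by (cases "n \<le> m") auto
    then show ?thesis by blast
  qed
  have "MCauchy s"
    unfolding MCauchy_def using small sH by (simp add: ip_dist_def image_subset_iff)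
  then obtain g where g: "limitin mtopology s g sequentially"
    using mcomplete mcomplete_def by blast
  then have gH: "g \<in> H" by (simp add: limitin_metric)
  have lim: "(\<lambda>N. ip_norm ip (g - s N)) \<longlonglongrightarrow> 0"
  proof (rule tendstoI)
    fix \<epsilon> :: real assume "\<epsilon> > 0"
    then have "eventually (\<lambda>N. ip_dist H ip (s N) g < \<epsilon>) sequentially"
      using g unfolding limitin_metric by (auto elim: eventually_mono)
    then show "eventually (\<lambda>N. dist (ip_norm ip (g - s N)) 0 < \<epsilon>) sequentially"
      using gH sH ip_norm_nonneg diff_in ip_norm_diff_sym by (simp add: ip_dist_def)
  qed
  have "ip g (e m) = a m" for m
  proof -
    have "(\<lambda>N. ip g (e m) - ip (s N) (e m)) \<longlonglongrightarrow> 0"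
    proof (rule Lim_null_comparison[OF _ lim])
      show "eventually (\<lambda>N. cmod (ip g (e m) - ip (s N) (e m)) \<le> ip_norm ip (g - s N)) sequentially"
        using cmod_ip_le[OF diff_in[OF gH sH] e_in]
        by (simp add: ip_diff[OF gH sH e_in] ip_norm_e)
    qed
    moreover have "(\<lambda>N. ip g (e m) - ip (s N) (e m)) \<longlonglongrightarrow> ip g (e m) - a m"
    proof (rule tendsto_eventually)
      show "eventually (\<lambda>N. ip g (e m) - ip (s N) (e m) = ip g (e m) - a m) sequentially"
        using eventually_gt_at_top[of m] by eventually_elim (simp add: s_def ip_partial_sum)
    qed
    ultimately show ?thesis using LIMSEQ_unique by fastforce
  qed
  moreover have "ip_norm ip g \<le> B"
  proof (rule LIMSEQ_le_const)
    show "(\<lambda>N. ip_norm ip (g - s N) + B) \<longlonglongrightarrow> B"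
      using tendsto_add[OF lim tendsto_const[of B]] by simp
    have "ip_norm ip g \<le> ip_norm ip (g - s N) + B" for N
    proof -
      have "ip_norm ip g \<le> ip_norm ip (g - s N) + ip_norm ip (s N)"
        using ip_norm_triangle[OF diff_in[OF gH sH] sH, of N N] by simp
      moreover have "ip_norm ip (s N) \<le> B"
        using l2_bound_D[OF assms] by (simp add: s_def ip_norm_partial_sum)
      ultimately show ?thesis by linarith
    qed
    then show "\<exists>N. \<forall>n\<ge>N. ip_norm ip g \<le> ip_norm ip (g - s n) + B" by blast
  qed
  ultimately show thesis using that gH lim unfolding s_def by blast
qed

lemma fourier_expansion:
  assumes "f \<in> H"
  shows "(\<lambda>N. ip_norm ip (f - (\<Sum>n<N. cfun_scale (ip f (e n)) (e n)))) \<longlonglongrightarrow> 0"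
  by (rule riesz_fischer[OF bessel[OF assms]]) (use eqI_coeffs assms in metis)

text \<open>The converse of \<open>bessel\<close>; together they play the role of Parseval's
  identity without infinite sums.\<close>

lemma ip_norm_le:
  assumes "f \<in> H" "l2_bound (\<lambda>n. ip f (e n)) B"
  shows "ip_norm ip f \<le> B"
  by (rule riesz_fischer[OF assms(2)]) (use eqI_coeffs assms(1) in metis)

end

section \<open>Power series and coordinates in tridiagonal spaces\<close>

lemma L2_set_lessThan_mono: "(m::nat) \<le> n \<Longrightarrow> L2_set f {..<m} \<le> L2_set f {..<n}"
  unfolding L2_set_def by (intro real_sqrt_le_mono sum_mono2) auto

lemma L2_set_lessThan_Suc_le:
  assumes "f N \<ge> 0"
  shows "L2_set f {..<Suc N} \<le> L2_set f {..<N} + f N"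
proof -
  have "(L2_set f {..<Suc N})\<^sup>2 = (L2_set f {..<N})\<^sup>2 + (f N)\<^sup>2"
    by (simp add: L2_set_def sum_nonneg)
  also have "\<dots> \<le> (L2_set f {..<N} + f N)\<^sup>2"
    using assms by (simp add: power2_sum)
  finally show ?thesis
    by (rule power2_le_imp_le) (use assms in auto)
qed

text \<open>Delaying a sequence by one place does not increase the norm of its finite section. The
  section norm \<open>L\<close> of \<open>a\<close> therefore satisfies
  \<open>L \<le> B + r * L\<close>, and being finite it can be absorbed on the left.\<close>

lemma l2_bound_forward_recursion:
  assumes x: "l2_bound x B" and r: "0 \<le> r" "r < 1"
    and a: "\<And>n. cmod (a n) \<le> cmod (x n) + r * cmod (case_nat 0 a n)"
  shows "l2_bound a (B / (1 - r))"
  unfolding l2_bound_def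
proof
  fix N
  let ?L = "\<lambda>u::nat \<Rightarrow> complex. L2_set (\<lambda>n. cmod (u n)) {..<N}"
  have shift: "?L (case_nat 0 a) \<le> ?L a"
  proof (cases N)
    case (Suc M)
    have "?L (case_nat 0 a) = L2_set (\<lambda>n. cmod (a n)) {..<M}"
      unfolding Suc L2_set_lessThan_Suc_shift by simp
    also have "\<dots> \<le> ?L a"
      using Suc by (intro L2_set_lessThan_mono) auto
    finally show ?thesis .
  qed auto
  have "?L a \<le> L2_set (\<lambda>n. cmod (x n) + r * cmod (case_nat 0 a n)) {..<N}"
    by (intro L2_set_mono a) auto
  also have "\<dots> \<le> ?L x + L2_set (\<lambda>n. r * cmod (case_nat 0 a n)) {..<N}"
    by (rule L2_set_triangle_ineq)
  also have "\<dots> = ?L x + r * ?L (case_nat 0 a)"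
    using r by (simp add: L2_set_right_distrib)
  also have "\<dots> \<le> B + r * ?L a"
    using r shift l2_bound_D[OF x, of N] by (intro add_mono mult_left_mono) auto
  finally show "?L a \<le> B / (1 - r)"
    using r by (simp add: field_simps)
qed

text \<open>Here the shift looks one place beyond the section, and \<open>M\<close> pays for that
  boundary term. Some bound is indispensable: for \<open>r > 0\<close> and \<open>a = 0\<close> the
  powers of \<open>1 / r\<close> satisfy the recursion.\<close>

lemma l2_bound_backward_recursion:
  assumes a: "l2_bound a B" and r: "0 \<le> r" "r < 1" and M: "\<And>n. cmod (d n) \<le> M"
    and d: "\<And>n. cmod (d n) \<le> cmod (a n) + r * cmod (d (Suc n))"
  shows "l2_bound d ((B + r * M) / (1 - r))"
  unfolding l2_bound_def
proof
  fix N
  let ?L = "\<lambda>u::nat \<Rightarrow> complex. L2_set (\<lambda>n. cmod (u n)) {..<N}"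
  have "?L (\<lambda>n. d (Suc n)) \<le> L2_set (\<lambda>n. cmod (d n)) {..<Suc N}"
    unfolding L2_set_lessThan_Suc_shift by (intro real_le_rsqrt) auto
  also have "\<dots> \<le> ?L d + cmod (d N)"
    by (rule L2_set_lessThan_Suc_le) auto
  also have "\<dots> \<le> ?L d + M"
    using M by simp
  finally have shift: "?L (\<lambda>n. d (Suc n)) \<le> ?L d + M" .
  have "?L d \<le> L2_set (\<lambda>n. cmod (a n) + r * cmod (d (Suc n))) {..<N}"
    by (intro L2_set_mono d) auto
  also have "\<dots> \<le> ?L a + L2_set (\<lambda>n. r * cmod (d (Suc n))) {..<N}"
    by (rule L2_set_triangle_ineq)
  also have "\<dots> = ?L a + r * ?L (\<lambda>n. d (Suc n))"
    using r by (simp add: L2_set_right_distrib)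
  also have "\<dots> \<le> B + r * (?L d + M)"
    using r shift l2_bound_D[OF a, of N] by (intro add_mono mult_left_mono) auto
  finally show "?L d \<le> (B + r * M) / (1 - r)"
    using r by (simp add: field_simps)
qed

text \<open>Iterating the inequality \<open>k\<close> times gives the bound
  \<open>r ^ k * M\<close>, which tends to 0.\<close>

lemma backward_recursion_eq_0:
  fixes D :: "nat \<Rightarrow> complex"
  assumes r: "0 \<le> r" "r < 1" and M: "\<And>n. cmod (D n) \<le> M"
    and D: "\<And>n. cmod (D n) \<le> r * cmod (D (Suc n))"
  shows "D n = 0"
proof -
  have "cmod (D n) \<le> r ^ k * M" for k n
  proof (induction k arbitrary: n)
    case (Suc k)
    have "cmod (D n) \<le> r * (r ^ k * M)"
      using D[of n] mult_left_mono[OF Suc[of "Suc n"] r(1)] by linarith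
    then show ?case by (simp add: mult.assoc)
  qed (use M in simp)
  moreover have "(\<lambda>k. r ^ k * M) \<longlonglongrightarrow> 0"
    using r by (intro tendsto_mult_left_zero LIMSEQ_realpow_zero) auto
  ultimately have "cmod (D n) \<le> 0"
    by (intro LIMSEQ_le_const) auto
  then show ?thesis by simp
qed

lemma sum_fun_apply: "(\<Sum>n\<in>A. F n) x = (\<Sum>n\<in>A. F n x)"
proof (induction A rule: infinite_finite_induct)
  case (insert a A)
  then show ?case unfolding sum.insert[OF insert.hyps] by simp
qed auto

section \<open>Power series expansion of the elements of H\<close>

locale bounded_tridiagonal_space = tridiagonal_space +
  fixes A r :: real
  assumes \<mu>_nonzero: "\<mu> n \<noteq> 0"
    and A: "A \<ge> 1" and \<mu>_ratio: "cmod (\<mu> n) \<le> A * cmod (\<mu> (Suc n))"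
    and r: "0 \<le> r" "r < 1" and \<nu>_ratio: "cmod (\<nu> n) \<le> r * cmod (\<mu> (Suc n))"
begin

abbreviation e where "e \<equiv> tridiag_basis \<mu> \<nu>"

sublocale hilbert_fun_basis H ip e
  by unfold_locales (rule complete, rule orthonormal_basis)

lemma e_apply: "z \<in> ball 0 1 \<Longrightarrow> e n z = \<mu> n * z ^ n + \<nu> n * z ^ Suc n"
  by (simp add: tridiag_basis_def)

text \<open>The squares of the absolute values are the terms of the convergent kernel series on the
  diagonal.\<close>

lemma e_tendsto_0:
  assumes "z \<in> ball 0 1"
  shows "(\<lambda>n. e n z) \<longlonglongrightarrow> 0"
proof -
  have "(\<lambda>n. e n z * cnj (e n z)) \<longlonglongrightarrow> 0"
    by (rule summable_LIMSEQ_zero[OF kernel_summable[OF assms assms]])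
  then have "(\<lambda>n. cmod (e n z * cnj (e n z))) \<longlonglongrightarrow> 0"
    by (rule tendsto_norm_zero)
  then have "(\<lambda>n. (cmod (e n z))\<^sup>2) \<longlonglongrightarrow> 0"
    by (simp add: norm_mult power2_eq_square)
  then have "(\<lambda>n. sqrt ((cmod (e n z))\<^sup>2)) \<longlonglongrightarrow> sqrt 0"
    by (rule tendsto_real_sqrt)
  then show ?thesis by (simp add: tendsto_norm_zero_iff)
qed

text \<open>Adding \<open>e n z\<close> and \<open>(- 1) ^ n * e n (- z)\<close> cancels the term with \<open>\<nu> n\<close>.\<close>

lemma \<mu>_power_tendsto_0:
  assumes "z \<in> ball 0 1"
  shows "(\<lambda>n. \<mu> n * z ^ n) \<longlonglongrightarrow> 0"
proof -
  have z': "- z \<in> ball 0 1" using assms by simp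
  have "(\<lambda>n. (cmod (e n z) + cmod (e n (- z))) / 2) \<longlonglongrightarrow> (0 + 0) / 2"
    by (intro tendsto_intros tendsto_norm_zero e_tendsto_0 assms z') auto
  then have lim: "(\<lambda>n. (cmod (e n z) + cmod (e n (- z))) / 2) \<longlonglongrightarrow> 0" by simp
  have "cmod (\<mu> n * z ^ n) \<le> (cmod (e n z) + cmod (e n (- z))) / 2" for n
  proof -
    have "2 * (\<mu> n * z ^ n) = e n z + (- 1) ^ n * e n (- z)"
      unfolding e_apply[OF assms] e_apply[OF z']
      by (simp add: power_minus[of z] algebra_simps)
    then have "cmod (2 * (\<mu> n * z ^ n)) \<le> cmod (e n z) + cmod ((- 1) ^ n * e n (- z))"
      by (metis norm_triangle_ineq)
    then show ?thesis by (simp add: norm_mult norm_power)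
  qed
  then show ?thesis
    by (intro Lim_null_comparison[OF _ lim]) simp
qed

lemma \<nu>_power_tendsto_0:
  assumes "z \<in> ball 0 1"
  shows "(\<lambda>n. \<nu> n * z ^ Suc n) \<longlonglongrightarrow> 0"
proof (rule Lim_null_comparison)
  show "(\<lambda>n. cmod (\<mu> (Suc n) * z ^ Suc n)) \<longlonglongrightarrow> 0"
    using LIMSEQ_Suc[OF \<mu>_power_tendsto_0[OF assms]] by (rule tendsto_norm_zero)
  have "cmod (\<nu> n) \<le> cmod (\<mu> (Suc n))" for n
    using \<nu>_ratio[of n] r mult_left_le_one_le[of "cmod (\<mu> (Suc n))" r] by simp
  then show "\<forall>\<^sub>F n in sequentially. cmod (\<nu> n * z ^ Suc n) \<le> cmod (\<mu> (Suc n) * z ^ Suc n)"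
    by (intro always_eventually allI) (simp only: norm_mult mult_right_mono norm_ge_zero)
qed

text \<open>Point evaluation is bounded, so it turns the norm-convergent Fourier expansion into a
  pointwise one.\<close>

lemma evaluation_sums:
  assumes "f \<in> H" "z \<in> ball 0 1"
  shows "(\<lambda>n. ip f (e n) * e n z) sums f z"
proof -
  obtain C where C: "\<And>f. f \<in> H \<Longrightarrow> cmod (f z) \<le> C * ip_norm ip f"
    using eval_bounded[OF assms(2)] by blast
  define s where "s N = (\<Sum>n<N. cfun_scale (ip f (e n)) (e n))" for N
  have s: "s N \<in> H" for N by (simp add: s_def partial_sum_in)
  have "(\<lambda>N. C * ip_norm ip (f - s N)) \<longlonglongrightarrow> C * 0"
    unfolding s_def by (intro tendsto_mult tendsto_const fourier_expansion assms)
  then have lim: "(\<lambda>N. C * ip_norm ip (f - s N)) \<longlonglongrightarrow> 0" by (simp only: mult_zero_right)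
  have "(\<lambda>N. s N z - f z) \<longlonglongrightarrow> 0"
  proof (rule Lim_null_comparison[OF always_eventually[OF allI] lim])
    fix N show "cmod (s N z - f z) \<le> C * ip_norm ip (f - s N)"
      using C[OF diff_in[OF assms(1) s]] by (simp add: norm_minus_commute)
  qed
  then have "(\<lambda>N. s N z) \<longlonglongrightarrow> f z"
    by (simp add: LIM_zero_iff)
  then show ?thesis
    by (simp add: s_def sums_def sum_fun_apply cfun_scale_def)
qed

text \<open>The weights of the shift \<open>W\<close>.\<close>

definition \<omega> :: "nat \<Rightarrow> complex" where "\<omega> n = \<nu> n / \<mu> (Suc n)"

lemma \<omega>_le: "cmod (\<omega> n) \<le> r"
  using \<nu>_ratio[of n] \<mu>_nonzero[of "Suc n"] by (simp add: \<omega>_def norm_divide field_simps)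

lemma \<nu>_eq: "\<nu> n = \<omega> n * \<mu> (Suc n)"
  using \<mu>_nonzero[of "Suc n"] by (simp add: \<omega>_def)

text \<open>
  The numbers \<open>pcoeff f n * \<mu> n\<close> are the Taylor coefficients of \<open>f\<close> at \<open>0\<close>.
\<close>

definition pcoeff :: "(complex \<Rightarrow> complex) \<Rightarrow> nat \<Rightarrow> complex" where
  "pcoeff f n = ip f (e n) + case_nat 0 (\<lambda>m. \<omega> m * ip f (e m)) n"

lemma pcoeff_l2_bound:
  assumes "f \<in> H"
  shows "l2_bound (pcoeff f) ((1 + r) * ip_norm ip f)"
proof -
  have "l2_bound (pcoeff f) (ip_norm ip f + r * ip_norm ip f)"
    unfolding pcoeff_def
    using \<omega>_le r by (intro l2_bound_add l2_bound_unshift l2_bound_mult bessel assms) auto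
  then show ?thesis by (simp add: distrib_right)
qed

lemma power_series:
  assumes "f \<in> H" "z \<in> ball 0 1"
  shows "(\<lambda>n. pcoeff f n * \<mu> n * z ^ n) sums f z"
proof -
  \<comment> \<open>Regrouping by powers of \<open>z\<close> splits the last basis function: its
    term of degree \<open>Suc N\<close> lies outside the partial sum. This boundary term vanishes in
    the limit, since the coefficients of \<open>f\<close> are bounded.\<close>
  have partial: "(\<Sum>n<Suc N. pcoeff f n * \<mu> n * z ^ n) =
      (\<Sum>n<Suc N. ip f (e n) * e n z) - ip f (e N) * (\<nu> N * z ^ Suc N)" for N
  proof (induction N)
    case 0
    show ?case by (simp add: pcoeff_def e_apply[OF assms(2)] algebra_simps)
  next
    case (Suc N)
    show ?case
      unfolding sum.lessThan_Suc[of _ "Suc N"] Suc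
      by (simp add: pcoeff_def e_apply[OF assms(2)] \<nu>_eq[of N] algebra_simps)
  qed
  have "(\<lambda>N. ip_norm ip f * cmod (\<nu> N * z ^ Suc N)) \<longlonglongrightarrow> ip_norm ip f * 0"
    by (intro tendsto_mult tendsto_const tendsto_norm_zero \<nu>_power_tendsto_0 assms)
  then have lim: "(\<lambda>N. ip_norm ip f * cmod (\<nu> N * z ^ Suc N)) \<longlonglongrightarrow> 0" by (simp only: mult_zero_right)
  have "(\<lambda>N. ip f (e N) * (\<nu> N * z ^ Suc N)) \<longlonglongrightarrow> 0"
  proof (rule Lim_null_comparison[OF always_eventually[OF allI] lim])
    fix N show "cmod (ip f (e N) * (\<nu> N * z ^ Suc N)) \<le> ip_norm ip f * cmod (\<nu> N * z ^ Suc N)"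
      unfolding norm_mult[of "ip f (e N)"]
      by (intro mult_right_mono l2_bound_component[OF bessel] assms norm_ge_zero)
  qed
  then have "(\<lambda>N. \<Sum>n<Suc N. pcoeff f n * \<mu> n * z ^ n) \<longlonglongrightarrow> f z - 0"
    unfolding partial
    using LIMSEQ_Suc[OF evaluation_sums[OF assms, unfolded sums_def]] by (rule tendsto_diff[rotated])
  then show ?thesis unfolding sums_def by (subst (asm) filterlim_sequentially_Suc) simp
qed

text \<open>Inverts \<open>1 + W\<close> by solving the lower bidiagonal system for the basis
  coefficients; \<open>1 / (1 - r)\<close> is the Neumann constant.\<close>

lemma ex_pcoeff:
  assumes "l2_bound x B"
  obtains f where "f \<in> H" "pcoeff f = x" "ip_norm ip f \<le> B / (1 - r)"
proof -
  define a where "a = rec_nat (x 0) (\<lambda>n y. x (Suc n) - \<omega> n * y)"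
  have a: "a n = x n - case_nat 0 (\<lambda>m. \<omega> m * a m) n" for n
    by (cases n) (simp_all add: a_def)
  have "cmod (a n) \<le> cmod (x n) + r * cmod (case_nat 0 a n)" for n
  proof (cases n)
    case 0
    then show ?thesis by (simp add: a_def)
  next
    case (Suc m)
    have "cmod (a n) \<le> cmod (x n) + cmod (\<omega> m * a m)"
      using a[of n] Suc norm_triangle_ineq4[of "x n" "\<omega> m * a m"] by simp
    also have "cmod (\<omega> m * a m) \<le> r * cmod (a m)"
      unfolding norm_mult by (intro mult_right_mono \<omega>_le) simp
    finally show ?thesis using Suc by simp
  qed
  then have "l2_bound a (B / (1 - r))"
    by (rule l2_bound_forward_recursion[OF assms r])
  then obtain f where f: "f \<in> H" "\<And>n. ip f (e n) = a n" "ip_norm ip f \<le> B / (1 - r)"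
    by (rule riesz_fischer) blast
  have "pcoeff f = x"
  proof
    fix n show "pcoeff f n = x n"
      unfolding pcoeff_def f(2) using a[of n] by simp
  qed
  with f that show thesis by blast
qed

lemma eq_onI:
  assumes "f \<in> H" "\<And>z. z \<in> ball 0 1 \<Longrightarrow> f z = g z" "\<And>z. z \<notin> ball 0 1 \<Longrightarrow> g z = 0"
  shows "f = g"
  using assms vanishes[OF assms(1)] by (metis ext)

text \<open>Multiplication by \<open>z\<close> moves Taylor coefficients up by one, so in terms of
  \<open>pcoeff\<close> it is a weighted forward shift with weights at most \<open>A\<close>. An
  element with the shifted coefficients is built first and then identified through its power series.
  The factors \<open>1 + r\<close> and \<open>1 / (1 - r)\<close> are the costs of entering and
  leaving these coefficients.\<close>

lemma mult_z_in_and_bound: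
  assumes "f \<in> H"
  shows "mult_z f \<in> H \<and> ip_norm ip (mult_z f) \<le> A * (1 + r) / (1 - r) * ip_norm ip f"
proof -
  define x where "x = case_nat 0 (\<lambda>n. \<mu> n / \<mu> (Suc n) * pcoeff f n)"
  have "cmod (\<mu> n / \<mu> (Suc n)) \<le> A" for n
    using \<mu>_ratio[of n] \<mu>_nonzero[of "Suc n"] by (simp add: norm_divide field_simps)
  then have "l2_bound x (A * ((1 + r) * ip_norm ip f))"
    unfolding x_def
    using A by (intro l2_bound_unshift l2_bound_mult pcoeff_l2_bound assms) auto
  then obtain F where F: "F \<in> H" "pcoeff F = x"
      "ip_norm ip F \<le> A * ((1 + r) * ip_norm ip f) / (1 - r)"
    by (rule ex_pcoeff)
  have "F = mult_z f"
  proof (rule eq_onI[OF F(1)])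
    fix z :: complex assume z: "z \<in> ball 0 1"
    have "(\<lambda>n. z * (pcoeff f n * \<mu> n * z ^ n)) sums (z * f z)"
      by (intro sums_mult power_series assms z)
    also have "(\<lambda>n. z * (pcoeff f n * \<mu> n * z ^ n)) = (\<lambda>n. x (Suc n) * \<mu> (Suc n) * z ^ Suc n)"
      using \<mu>_nonzero by (simp add: x_def fun_eq_iff)
    finally have "(\<lambda>n. x n * \<mu> n * z ^ n) sums (z * f z)"
      by (subst (asm) sums_Suc_iff) (simp add: x_def)
    moreover have "(\<lambda>n. x n * \<mu> n * z ^ n) sums F z"
      using power_series[OF F(1) z] by (simp add: F(2))
    ultimately show "F z = mult_z f z"
      unfolding mult_z_def by (rule sums_unique2[symmetric])
  qed (use vanishes[OF assms] in \<open>simp add: mult_z_def\<close>)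
  then show ?thesis using F by (simp add: mult.assoc)
qed

lemma mult_z_in: "f \<in> H \<Longrightarrow> mult_z f \<in> H"
  by (simp add: mult_z_in_and_bound)

section \<open>Monomials and the pairings with them\<close>

definition p :: "nat \<Rightarrow> complex \<Rightarrow> complex" where
  "p n z = (if z \<in> ball 0 1 then z ^ n else 0)"

lemma p_in_and_bound: "p n \<in> H \<and> ip_norm ip (p n) \<le> 1 / cmod (\<mu> n) / (1 - r)"
proof -
  define x where "x = (\<lambda>m. if m = n then 1 / \<mu> n else 0)"
  have "l2_bound x (\<Sum>m<Suc n. cmod (x m))"
    by (rule l2_bound_finite_sum) (auto simp: x_def)
  moreover have "(\<Sum>m<Suc n. cmod (x m)) = 1 / cmod (\<mu> n)"
    by (simp add: x_def norm_divide)
  ultimately obtain F where F: "F \<in> H" "pcoeff F = x" "ip_norm ip F \<le> 1 / cmod (\<mu> n) / (1 - r)"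
    using ex_pcoeff[of x] by metis
  have "F = p n"
  proof (rule eq_onI[OF F(1)])
    fix z :: complex assume z: "z \<in> ball 0 1"
    have "(\<lambda>m. x m * \<mu> m * z ^ m) = (\<lambda>m. if m = n then z ^ m else 0)"
      using \<mu>_nonzero by (auto simp: x_def)
    then have "(\<lambda>m. x m * \<mu> m * z ^ m) sums (z ^ n)"
      using sums_single[of n "\<lambda>m. z ^ m"] by simp
    moreover have "(\<lambda>n. x n * \<mu> n * z ^ n) sums F z"
      using power_series[OF F(1) z] by (simp add: F(2))
    ultimately have "F z = z ^ n" by (rule sums_unique2[symmetric])
    then show "F z = p n z"
      using z by (simp add: p_def)
  qed (simp add: p_def)
  then show ?thesis using F by simp
qed

lemma p_in: "p n \<in> H"
  by (simp add: p_in_and_bound)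

lemma mult_z_p: "mult_z (p n) = p (Suc n)"
  by (auto simp: mult_z_def p_def)

lemma e_eq_p: "e n = cfun_scale (\<mu> n) (p n) + cfun_scale (\<nu> n) (p (Suc n))"
  by (auto simp: fun_eq_iff cfun_scale_def p_def tridiag_basis_def)

text \<open>
  In the coordinates \<open>coord g n\<close> the adjoint of \<open>mult_z\<close> is the unweighted backward shift,
  and the norm of \<open>H\<close> is equivalent to the norm of \<open>\<ell>\<^sup>2\<close> with weights \<open>cmod (\<mu> n)\<close>.
\<close>

definition coord :: "(complex \<Rightarrow> complex) \<Rightarrow> nat \<Rightarrow> complex" where
  "coord g n = ip g (p n)"

text \<open>The upper bidiagonal system adjoint to the one behind \<open>pcoeff\<close>; the
  conjugates come from antilinearity in the second argument.\<close>

lemma ip_e_eq_coord: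
  assumes "g \<in> H"
  shows "ip g (e n) = cnj (\<mu> n) * coord g n + cnj (\<nu> n) * coord g (Suc n)"
  unfolding e_eq_p coord_def
  using assms by (simp only: ip_add_right ip_scale_right p_in scale_in)

lemma coord_diff: "f \<in> H \<Longrightarrow> g \<in> H \<Longrightarrow> coord (f - g) n = coord f n - coord g n"
  by (simp add: coord_def ip_diff p_in)

lemma coord_eqI:
  assumes "f \<in> H" "g \<in> H" "\<And>n. coord f n = coord g n"
  shows "f = g"
  using assms by (intro eqI_coeffs) (simp_all add: ip_e_eq_coord)

text \<open>Cauchy-Schwarz against the monomial. This is the a priori bound for the backward
  recursion, and later it limits the coordinates of an orbit.\<close>

lemma weighted_coord_le:
  assumes "g \<in> H"
  shows "cmod (\<mu> n * coord g n) \<le> ip_norm ip g / (1 - r)"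
proof -
  have "cmod (coord g n) \<le> ip_norm ip g * ip_norm ip (p n)"
    unfolding coord_def by (intro cmod_ip_le assms p_in)
  also have "\<dots> \<le> ip_norm ip g * (1 / cmod (\<mu> n) / (1 - r))"
    using p_in_and_bound ip_norm_nonneg[OF assms] by (intro mult_left_mono) auto
  finally show ?thesis
    using \<mu>_nonzero[of n] r by (simp add: norm_mult field_simps)
qed

lemma weighted_\<nu>_le: "cmod (cnj (\<nu> n) * y) \<le> r * cmod (\<mu> (Suc n) * y)"
  unfolding norm_mult complex_mod_cnj mult.assoc[symmetric] by (intro mult_right_mono \<nu>_ratio) simp

text \<open>Solving \<open>ip_e_eq_coord\<close> for its first term gives a backward recursion with
  ratio \<open>r\<close>. The exponent 2 arises from \<open>1 + r / (1 - r) = 1 / (1 - r)\<close>,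
  divided once more by \<open>1 - r\<close>.\<close>

lemma coord_l2_bound:
  assumes "g \<in> H"
  shows "l2_bound (\<lambda>n. \<mu> n * coord g n) (ip_norm ip g / (1 - r)\<^sup>2)"
proof -
  have "l2_bound (\<lambda>n. \<mu> n * coord g n) ((ip_norm ip g + r * (ip_norm ip g / (1 - r))) / (1 - r))"
  proof (rule l2_bound_backward_recursion[OF bessel[OF assms] r weighted_coord_le[OF assms]])
    fix n
    have "cnj (\<mu> n) * coord g n = ip g (e n) - cnj (\<nu> n) * coord g (Suc n)"
      using ip_e_eq_coord[OF assms] by simp
    then have "cmod (cnj (\<mu> n) * coord g n) \<le> cmod (ip g (e n)) + cmod (cnj (\<nu> n) * coord g (Suc n))"
      by (simp only: norm_triangle_ineq4)
    also have "cmod (cnj (\<nu> n) * coord g (Suc n)) \<le> r * cmod (\<mu> (Suc n) * coord g (Suc n))"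
      by (rule weighted_\<nu>_le)
    finally show "cmod (\<mu> n * coord g n) \<le> cmod (ip g (e n)) + r * cmod (\<mu> (Suc n) * coord g (Suc n))"
      by (simp add: norm_mult)
  qed
  moreover have "(ip_norm ip g + r * (ip_norm ip g / (1 - r))) / (1 - r) = ip_norm ip g / (1 - r)\<^sup>2"
    using r by (simp add: field_simps power2_eq_square)
  ultimately show ?thesis by simp
qed

lemma basis_coeff_l2_bound:
  assumes "l2_bound (\<lambda>n. \<mu> n * x n) B"
  shows "l2_bound (\<lambda>n. cnj (\<mu> n) * x n + cnj (\<nu> n) * x (Suc n)) (2 * B)"
proof -
  have "l2_bound (\<lambda>n. cnj (\<mu> n) * x n) (1 * B)"
    by (rule l2_bound_le_mult[OF assms]) (auto simp: norm_mult)
  moreover have "l2_bound (\<lambda>n. cnj (\<nu> n) * x (Suc n)) (r * B)"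
    by (rule l2_bound_le_mult[OF l2_bound_shift[OF assms]]) (use weighted_\<nu>_le r in auto)
  ultimately have "l2_bound (\<lambda>n. cnj (\<mu> n) * x n + cnj (\<nu> n) * x (Suc n)) (1 * B + r * B)"
    by (rule l2_bound_add)
  then show ?thesis
    using r l2_bound_nonneg[OF assms] mult_right_mono[of r 1 B] by (elim l2_bound_mono) auto
qed

lemma ip_norm_le_coord:
  assumes "g \<in> H" "l2_bound (\<lambda>n. \<mu> n * coord g n) B"
  shows "ip_norm ip g \<le> 2 * B"
  using basis_coeff_l2_bound[OF assms(2)] assms(1)
  by (intro ip_norm_le) (simp_all add: ip_e_eq_coord)

text \<open>Riesz-Fischer prescribes basis coefficients, not coordinates. The weighted difference of
  the coordinates from \<open>x\<close> solves the homogeneous backward recursion and is bounded,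
  hence it is zero.\<close>

lemma ex_coord:
  assumes "l2_bound (\<lambda>n. \<mu> n * x n) B"
  obtains g where "g \<in> H" "\<And>n. coord g n = x n"
proof -
  obtain g where g: "g \<in> H" "\<And>n. ip g (e n) = cnj (\<mu> n) * x n + cnj (\<nu> n) * x (Suc n)"
    using basis_coeff_l2_bound[OF assms] by (rule riesz_fischer) blast
  define D where "D n = \<mu> n * (coord g n - x n)" for n
  have D0: "D n = 0" for n
  proof (rule backward_recursion_eq_0[OF r])
    fix n
    have "cmod (D n) \<le> cmod (\<mu> n * coord g n) + cmod (\<mu> n * x n)"
      unfolding D_def right_diff_distrib by (rule norm_triangle_ineq4)
    then show "cmod (D n) \<le> ip_norm ip g / (1 - r) + B"
      using weighted_coord_le[OF g(1), of n] l2_bound_component[OF assms, of n] by linarith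
    have "cnj (\<mu> n) * (coord g n - x n) = - (cnj (\<nu> n) * (coord g (Suc n) - x (Suc n)))"
      using ip_e_eq_coord[OF g(1), of n] g(2)[of n] by (simp add: algebra_simps)
    then have "cmod (cnj (\<mu> n) * (coord g n - x n)) = cmod (cnj (\<nu> n) * (coord g (Suc n) - x (Suc n)))"
      by (simp only: norm_minus_cancel)
    then have "cmod (D n) = cmod (cnj (\<nu> n) * (coord g (Suc n) - x (Suc n)))"
      by (simp add: D_def norm_mult)
    also have "\<dots> \<le> r * cmod (D (Suc n))"
      unfolding D_def by (rule weighted_\<nu>_le)
    finally show "cmod (D n) \<le> r * cmod (D (Suc n))" .
  qed
  have "coord g n = x n" for n
    using D0[of n] \<mu>_nonzero[of n] by (simp add: D_def)
  with g(1) that show thesis by blast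
qed

section \<open>The adjoint as a backward shift\<close>

abbreviation T where "T \<equiv> adjoint_on H ip mult_z"

lemma mult_z_add: "mult_z (f + g) = mult_z f + mult_z g"
  by (simp add: mult_z_def fun_eq_iff algebra_simps)

lemma mult_z_scale: "mult_z (cfun_scale c f) = cfun_scale c (mult_z f)"
  by (simp add: mult_z_def cfun_scale_def fun_eq_iff)

lemma l2_bound_weighted_shift:
  assumes "l2_bound (\<lambda>n. \<mu> n * x n) B"
  shows "l2_bound (\<lambda>n. \<mu> n * x (Suc n)) (A * B)"
proof (rule l2_bound_le_mult[OF l2_bound_shift[OF assms]])
  fix n
  show "cmod (\<mu> n * x (Suc n)) \<le> A * cmod (\<mu> (Suc n) * x (Suc n))"
    unfolding norm_mult mult.assoc[symmetric] by (intro mult_right_mono \<mu>_ratio) simp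
qed (use A in simp)

text \<open>Both sides are bounded and linear in \<open>f\<close>, so it suffices to compare them on
  monomials. There the claim is the conjugate of the hypothesis on the coordinates of
  \<open>h\<close>.\<close>

lemma ip_mult_z_eq:
  assumes g: "g \<in> H" and h: "h \<in> H" "\<And>n. coord h n = coord g (Suc n)" and f: "f \<in> H"
  shows "ip (mult_z f) g = ip f h"
proof -
  define \<phi> where "\<phi> f = ip (mult_z f) g - ip f h" for f
  have add: "\<phi> (u + v) = \<phi> u + \<phi> v" if "u \<in> H" "v \<in> H" for u v
    unfolding \<phi>_def mult_z_add using that
    by (simp only: ip_add mult_z_in g h algebra_simps)
  have scale: "\<phi> (cfun_scale c u) = c * \<phi> u" if "u \<in> H" for u c
    unfolding \<phi>_def mult_z_scale using that
    by (simp only: ip_scale mult_z_in g h right_diff_distrib)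
  have "\<phi> (p n) = 0" for n
    using ip_cnj[OF p_in g, of "Suc n"] ip_cnj[OF p_in h(1), of n] h(2)[of n]
      ip_cnj[OF g p_in, of "Suc n"] ip_cnj[OF h(1) p_in, of n]
    by (simp add: \<phi>_def mult_z_p coord_def)
  then have zero: "\<phi> (e n) = 0" for n
    unfolding e_eq_p by (simp only: add scale p_in scale_in mult_zero_right add_0)
  have bound: "cmod (\<phi> u) \<le> (A * (1 + r) / (1 - r) * ip_norm ip g + ip_norm ip h) * ip_norm ip u"
    if "u \<in> H" for u
  proof -
    have "cmod (\<phi> u) \<le> cmod (ip (mult_z u) g) + cmod (ip u h)"
      unfolding \<phi>_def by (rule norm_triangle_ineq4)
    also have "\<dots> \<le> ip_norm ip (mult_z u) * ip_norm ip g + ip_norm ip u * ip_norm ip h"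
      using that by (intro add_mono cmod_ip_le mult_z_in g h)
    also have "\<dots> \<le> (A * (1 + r) / (1 - r) * ip_norm ip u) * ip_norm ip g + ip_norm ip u * ip_norm ip h"
      using mult_z_in_and_bound[OF that] ip_norm_nonneg[OF g] ip_norm_nonneg[OF h(1)] by (intro add_mono mult_right_mono) auto
    finally show ?thesis by (simp add: algebra_simps)
  qed
  have "\<phi> f = 0"
    by (rule bounded_functional_eq_0[OF add scale bound zero f])
  then show ?thesis by (simp add: \<phi>_def)
qed

lemma adjoint_unique:
  assumes "h \<in> H" "h' \<in> H" "\<And>f. f \<in> H \<Longrightarrow> ip f h = ip f h'"
  shows "h = h'"
  using assms ip_cnj[OF e_in assms(1)] ip_cnj[OF e_in assms(2)]
  by (intro eqI_coeffs) (simp_all add: e_in)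

text \<open>The definite description in \<open>adjoint_on\<close> is resolved by exhibiting a
  candidate: the element whose coordinates are shifted by one, which exists by
  \<open>ex_coord\<close>.\<close>

lemma T_in_and_coord:
  assumes "g \<in> H"
  shows "T g \<in> H \<and> (\<forall>n. coord (T g) n = coord g (Suc n))"
proof -
  obtain h where h: "h \<in> H" "\<And>n. coord h n = coord g (Suc n)"
    using ex_coord[OF l2_bound_weighted_shift[OF coord_l2_bound[OF assms]]] by blast
  have "T g = h"
    unfolding adjoint_on_def
  proof (rule the_equality)
    show "h \<in> H \<and> (\<forall>f\<in>H. ip (mult_z f) g = ip f h)"
      using h ip_mult_z_eq[OF assms h] by blast
    show "h' = h" if "h' \<in> H \<and> (\<forall>f\<in>H. ip (mult_z f) g = ip f h')" for h'
      using that h ip_mult_z_eq[OF assms h] by (intro adjoint_unique) auto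
  qed
  then show ?thesis using h by simp
qed

lemma T_in: "g \<in> H \<Longrightarrow> T g \<in> H"
  by (simp add: T_in_and_coord)

lemma coord_T: "g \<in> H \<Longrightarrow> coord (T g) n = coord g (Suc n)"
  by (simp add: T_in_and_coord)

lemma bounded_T: "bounded_operator_on H ip T"
proof -
  have "T (f + g) = T f + T g" if "f \<in> H" "g \<in> H" for f g
  proof (rule coord_eqI)
    fix n
    show "coord (T (f + g)) n = coord (T f + T g) n"
      unfolding coord_T[OF add_in[OF that]]
      using that by (simp only: coord_def ip_add p_in T_in) (simp only: coord_T[unfolded coord_def])
  qed (intro T_in add_in that)+
  moreover have "T (cfun_scale c f) = cfun_scale c (T f)" if "f \<in> H" for f c
  proof (rule coord_eqI)
    fix n
    show "coord (T (cfun_scale c f)) n = coord (cfun_scale c (T f)) n"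
      unfolding coord_T[OF scale_in[OF that]]
      using that by (simp only: coord_def ip_scale p_in T_in) (simp only: coord_T[unfolded coord_def])
  qed (intro T_in scale_in that)+
  moreover have "ip_norm ip (T f) \<le> 2 * A / (1 - r)\<^sup>2 * ip_norm ip f" if "f \<in> H" for f
  proof -
    have "l2_bound (\<lambda>n. \<mu> n * coord (T f) n) (A * (ip_norm ip f / (1 - r)\<^sup>2))"
      using l2_bound_weighted_shift[OF coord_l2_bound[OF that]] that by (simp add: coord_T)
    then show ?thesis
      using ip_norm_le_coord[OF T_in[OF that]] by fastforce
  qed
  ultimately show ?thesis
    unfolding bounded_operator_on_def using T_in by blast
qed

lemma T_power_in: "g \<in> H \<Longrightarrow> (T ^^ j) g \<in> H"
  by (induction j) (auto intro: T_in)

lemma coord_T_power: "g \<in> H \<Longrightarrow> coord ((T ^^ j) g) n = coord g (n + j)"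
proof (induction j arbitrary: n)
  case (Suc j)
  then show ?case using coord_T[OF T_power_in[OF Suc.prems], of j] by simp
qed simp

end

section \<open>Dynamics of the adjoint shift\<close>

text \<open>Finitely supported sequences are coded by lists because lists over a countable set are
  countable and can be enumerated.\<close>

definition list_seq :: "complex list \<Rightarrow> nat \<Rightarrow> complex" where
  "list_seq ys n = (if n < length ys then ys ! n else 0)"

text \<open>A right inverse of the \<open>k\<close>-fold backward shift on such sequences. The guard
  is needed because truncated subtraction would repeat the first entry below
  \<open>k\<close>.\<close>

definition shifted_list_seq :: "nat \<Rightarrow> complex list \<Rightarrow> nat \<Rightarrow> complex" where
  "shifted_list_seq k ys n = (if k \<le> n then list_seq ys (n - k) else 0)"

lemma L2_set_sum_le:
  "L2_set (\<lambda>n. cmod (\<Sum>j\<in>J. F j n)) A \<le> (\<Sum>j\<in>J. L2_set (\<lambda>n. cmod (F j n)) A)"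
proof (induction J rule: infinite_finite_induct)
  case (insert j J)
  have "L2_set (\<lambda>n. cmod (\<Sum>j\<in>insert j J. F j n)) A
      \<le> L2_set (\<lambda>n. cmod (F j n) + cmod (\<Sum>j\<in>J. F j n)) A"
    using insert by (intro L2_set_mono) (auto intro: norm_triangle_ineq)
  also have "\<dots> \<le> L2_set (\<lambda>n. cmod (F j n)) A + L2_set (\<lambda>n. cmod (\<Sum>j\<in>J. F j n)) A"
    by (rule L2_set_triangle_ineq)
  also have "\<dots> \<le> (\<Sum>j\<in>insert j J. L2_set (\<lambda>n. cmod (F j n)) A)"
    using insert by simp
  finally show ?case .
qed (auto simp: L2_set_0')

lemma geometric_half_tail_le: "(\<Sum>j=Suc k..<Suc n. (1/2::real) ^ j) \<le> (1/2) ^ k"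
proof (cases "k \<le> n")
  case True
  then have "(\<Sum>j=Suc k..<Suc n. (1/2::real) ^ j) = (1/2) ^ k - (1/2) ^ n"
    by (induction rule: dec_induct) auto
  then show ?thesis by simp
qed auto

context bounded_tridiagonal_space
begin

lemma shifted_list_l2_bound:
  "l2_bound (\<lambda>n. \<mu> n * shifted_list_seq k ys n)
    (\<Sum>i<length ys. cmod (\<mu> (i + k)) * cmod (list_seq ys i))"
proof -
  have "(\<Sum>n<length ys + k. cmod (\<mu> n * shifted_list_seq k ys n)) =
      (\<Sum>n=0+k..<length ys + k. cmod (\<mu> n * shifted_list_seq k ys n))"
    by (intro sum.mono_neutral_right) (auto simp: shifted_list_seq_def)
  also have "\<dots> = (\<Sum>i=0..<length ys. cmod (\<mu> (i + k) * shifted_list_seq k ys (i + k)))"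
    by (rule sum.shift_bounds_nat_ivl)
  also have "\<dots> = (\<Sum>i<length ys. cmod (\<mu> (i + k)) * cmod (list_seq ys i))"
    by (simp add: shifted_list_seq_def norm_mult atLeast0LessThan)
  finally show ?thesis
    using l2_bound_finite_sum[of "length ys + k" "\<lambda>n. \<mu> n * shifted_list_seq k ys n"]
    by (simp add: shifted_list_seq_def list_seq_def)
qed

lemma list_l2_bound:
  "l2_bound (\<lambda>n. \<mu> n * list_seq ys n) (\<Sum>i<length ys. cmod (\<mu> i) * cmod (list_seq ys i))"
  using shifted_list_l2_bound[of 0 ys] by (simp add: shifted_list_seq_def)

text \<open>Cut off the tail of the coordinates and move the remaining ones into \<open>D\<close>.
  Each change costs at most \<open>\<epsilon> / 5\<close> in the weighted norm, and the norm
  equivalence doubles the total to four fifths of \<epsilon>.\<close>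

lemma lists_dense:
  assumes D: "\<And>X. open X \<Longrightarrow> X \<noteq> {} \<Longrightarrow> \<exists>d\<in>D. d \<in> X"
    and g: "g \<in> H" and \<epsilon>: "\<epsilon> > 0"
  obtains ys u where "ys \<in> lists D" "u \<in> H" "\<And>n. coord u n = list_seq ys n"
    "ip_norm ip (g - u) < \<epsilon>"
proof -
  obtain N where N: "l2_bound (\<lambda>n. if n < N then 0 else \<mu> n * coord g n) (\<epsilon> / 5)"
    by (rule l2_bound_tail[OF coord_l2_bound[OF g], of "\<epsilon> / 5"]) (use \<epsilon> in auto)
  \<comment> \<open>Chosen so that \<open>N\<close> weighted errors sum to at most
    \<open>\<epsilon> / 5\<close>; \<open>N\<close> itself may be 0.\<close>
  define \<eta> where "\<eta> n = \<epsilon> / 5 / (real N + 1) / cmod (\<mu> n)" for n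
  have \<eta>: "\<eta> n > 0" for n
    using \<epsilon> \<mu>_nonzero[of n] by (simp add: \<eta>_def)
  have "\<exists>d\<in>D. d \<in> ball (coord g n) (\<eta> n)" for n
    using D[OF open_ball] \<eta>[of n] by (simp only: ball_eq_empty not_le)
  then obtain y where y: "\<And>n. y n \<in> D" "\<And>n. y n \<in> ball (coord g n) (\<eta> n)"
    by metis
  define ys where "ys = map y [0..<N]"
  obtain u where u: "u \<in> H" "\<And>n. coord u n = list_seq ys n"
    using ex_coord[OF list_l2_bound] by blast
  define t where "t n = (if n < N then \<mu> n * (coord g n - y n) else 0)" for n
  have t_le: "cmod (t n) \<le> \<epsilon> / 5 / (real N + 1)" if "n < N" for n
  proof -
    have "cmod (t n) \<le> cmod (\<mu> n) * \<eta> n"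
      using y(2)[of n] that by (simp add: t_def norm_mult dist_norm mult_left_mono)
    then show ?thesis using \<mu>_nonzero[of n] by (simp add: \<eta>_def)
  qed
  have "(\<Sum>n<N. cmod (t n)) \<le> (\<Sum>n<N. \<epsilon> / 5 / (real N + 1))"
    by (intro sum_mono t_le) simp
  also have "\<dots> \<le> \<epsilon> / 5"
    using \<epsilon> by (simp add: field_simps)
  finally have "l2_bound t (\<epsilon> / 5)"
    by (intro l2_bound_mono[OF l2_bound_finite_sum[of N t]]) (simp_all add: t_def)
  then have "l2_bound (\<lambda>n. (if n < N then 0 else \<mu> n * coord g n) + t n) (\<epsilon> / 5 + \<epsilon> / 5)"
    by (rule l2_bound_add[OF N])
  also have "(\<lambda>n. (if n < N then 0 else \<mu> n * coord g n) + t n) = (\<lambda>n. \<mu> n * coord (g - u) n)"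
    unfolding coord_diff[OF g u(1)] u(2)
    by (auto simp: t_def list_seq_def ys_def algebra_simps)
  finally have "ip_norm ip (g - u) \<le> 2 * (\<epsilon> / 5 + \<epsilon> / 5)"
    by (rule ip_norm_le_coord[OF diff_in[OF g u(1)]])
  also have "\<dots> < \<epsilon>" using \<epsilon> by simp
  finally have "ip_norm ip (g - u) < \<epsilon>" .
  moreover have "ys \<in> lists D" using y(1) by (auto simp: ys_def)
  ultimately show thesis using that u by blast
qed

section \<open>Necessity of small weights for hypercyclicity\<close>

text \<open>Within distance 1 the coordinate of index 0 changes by at most \<open>K\<close>, so a
  centre with coordinate \<open>\<bar>R\<bar> + K\<close> suffices. The ball is a target that orbits
  can hit only with large coordinates.\<close>

lemma ex_ball_large_coord:
  obtains u where "u \<in> H" "\<And>g. g \<in> H \<Longrightarrow> ip_norm ip (u - g) < 1 \<Longrightarrow> R \<le> cmod (coord g 0)"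
proof -
  define K where "K = 1 / (cmod (\<mu> 0) * (1 - r))"
  obtain u where u: "u \<in> H" "\<And>n. coord u n = list_seq [of_real (\<bar>R\<bar> + K)] n"
    using ex_coord[OF list_l2_bound] by blast
  have K: "K > 0" using r \<mu>_nonzero[of 0] by (simp add: K_def)
  have "R \<le> cmod (coord g 0)" if g: "g \<in> H" "ip_norm ip (u - g) < 1" for g
  proof -
    have "cmod (\<mu> 0 * coord (u - g) 0) \<le> ip_norm ip (u - g) / (1 - r)"
      by (rule weighted_coord_le[OF diff_in[OF u(1) g(1)]])
    also have "\<dots> \<le> 1 / (1 - r)"
      using g(2) r by (intro divide_right_mono) auto
    finally have "cmod (coord (u - g) 0) \<le> K"
      using r \<mu>_nonzero[of 0] by (simp add: K_def norm_mult field_simps)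
    then have "cmod (coord u 0 - coord g 0) \<le> K"
      by (simp only: coord_diff[OF u(1) g(1)])
    moreover have "coord u 0 = of_real (\<bar>R\<bar> + K)"
      by (simp add: u(2) list_seq_def)
    then have "cmod (coord u 0) = \<bar>R\<bar> + K"
      using K by (simp only: norm_of_real)
    ultimately show ?thesis
      using norm_triangle_ineq2[of "coord u 0" "coord g 0"] by linarith
  qed
  with u(1) that show thesis by blast
qed

text \<open>The orbit shows at index 0 the successive coordinates of \<open>f\<close>. Weights
  bounded away from 0 would keep these bounded, and the orbit would miss a ball.\<close>

lemma hypercyclic_imp_small_\<mu>:
  assumes "hypercyclic_on H ip T" "\<epsilon> > 0"
  shows "\<exists>n\<ge>N. cmod (\<mu> n) < \<epsilon>"
proof (rule ccontr)
  assume "\<not> ?thesis"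
  then have large: "cmod (\<mu> n) \<ge> \<epsilon>" if "n \<ge> N" for n
    using that by force
  obtain f where f: "f \<in> H" and "mtopology closure_of (range (\<lambda>n. (T ^^ n) f)) = H"
    using assms(1) unfolding hypercyclic_on_def by (elim conjE bexE)
  note dense = this(2)[unfolded closure_eq_H_iff, rule_format]
  define K where "K = ip_norm ip f / (1 - r) / \<epsilon>"
  have K: "K \<ge> 0"
    using ip_norm_nonneg[OF f] r assms(2) by (simp add: K_def)
  \<comment> \<open>Exceeds the coordinates before \<open>N\<close> through the sum and the later
    ones through \<open>K\<close>.\<close>
  define R where "R = (\<Sum>n<N. cmod (coord f n)) + K + 1"
  obtain u where u: "u \<in> H" "\<And>g. g \<in> H \<Longrightarrow> ip_norm ip (u - g) < 1 \<Longrightarrow> R \<le> cmod (coord g 0)"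
    using ex_ball_large_coord by blast
  obtain n where "ip_norm ip (u - (T ^^ n) f) < 1"
    using dense[OF u(1) zero_less_one] by (elim bexE) blast
  then have "R \<le> cmod (coord ((T ^^ n) f) 0)"
    by (intro u(2) T_power_in[OF f])
  then have R: "R \<le> cmod (coord f n)"
    by (simp only: coord_T_power[OF f] add_0)
  show False
  proof (cases "n < N")
    case True
    then have "cmod (coord f n) \<le> (\<Sum>n<N. cmod (coord f n))"
      by (intro member_le_sum) auto
    then show False using R K by (simp add: R_def)
  next
    case False
    then have "\<epsilon> * cmod (coord f n) \<le> cmod (\<mu> n * coord f n)"
      using large[of n] by (simp add: norm_mult mult_right_mono)
    also have "\<dots> \<le> ip_norm ip f / (1 - r)"
      by (rule weighted_coord_le[OF f])
    finally have "cmod (coord f n) \<le> K"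
      using assms(2) pos_le_divide_eq[of \<epsilon> "cmod (coord f n)" "ip_norm ip f / (1 - r)"]
      by (simp only: K_def mult.commute)
    moreover have "(\<Sum>n<N. cmod (coord f n)) \<ge> 0" by (intro sum_nonneg) auto
    ultimately show False using R by (simp add: R_def)
  qed
qed

section \<open>Construction of a hypercyclic vector\<close>

lemma \<mu>_le_power: "cmod (\<mu> m) \<le> A ^ k * cmod (\<mu> (m + k))"
proof (induction k)
  case (Suc k)
  also have "A ^ k * cmod (\<mu> (m + k)) \<le> A ^ k * (A * cmod (\<mu> (Suc (m + k))))"
    using A by (intro mult_left_mono \<mu>_ratio) simp
  finally show ?case by (simp add: mult.assoc mult.left_commute)
qed simp

text \<open>One very small weight at \<open>t\<close> makes all weights in the window of length
  \<open>Q + L\<close> before \<open>t\<close> small, at the cost of a factor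
  \<open>A ^ (Q + L)\<close>. A block ending at \<open>t\<close> therefore stays small after a
  further backward shift by any \<open>q \<le> Q\<close>. Uniformity in \<open>q\<close> is needed
  because the same block must be negligible when each earlier block is brought to the
  origin.\<close>

lemma ex_small_shift:
  assumes small: "\<forall>\<epsilon>>0. \<forall>N. \<exists>n\<ge>N. cmod (\<mu> n) < \<epsilon>" and \<epsilon>: "\<epsilon> > 0"
  shows "\<exists>n\<ge>M. \<forall>q\<le>Q. (\<Sum>i<length ys. cmod (\<mu> (i + (n - q))) * cmod (list_seq ys i)) \<le> \<epsilon>"
proof -
  define L where "L = length ys"
  define S where "S = (\<Sum>i<L. cmod (list_seq ys i))"
  have S: "S \<ge> 0" unfolding S_def by (intro sum_nonneg) auto
  have pos: "\<epsilon> / (S + 1) / A ^ (Q + L) > 0" using \<epsilon> S A by simp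
  obtain t where t: "t \<ge> M + L + Q" "cmod (\<mu> t) < \<epsilon> / (S + 1) / A ^ (Q + L)"
    using small pos by blast
  have "(\<Sum>i<L. cmod (\<mu> (i + (t - L - q))) * cmod (list_seq ys i)) \<le> \<epsilon>" if q: "q \<le> Q" for q
  proof -
    have "cmod (\<mu> (i + (t - L - q))) \<le> \<epsilon> / (S + 1)" if "i < L" for i
    proof -
      define m where "m = i + (t - L - q)"
      have m: "m \<le> t" "t - m \<le> Q + L"
        using q t(1) that by (auto simp: m_def)
      have "cmod (\<mu> m) \<le> A ^ (t - m) * cmod (\<mu> t)"
        using \<mu>_le_power[of m "t - m"] m(1) by simp
      also have "\<dots> \<le> A ^ (Q + L) * cmod (\<mu> t)"
        using A m(2) by (intro mult_right_mono power_increasing) auto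
      also have "\<dots> \<le> \<epsilon> / (S + 1)"
        using t(2) A pos_less_divide_eq[of "A ^ (Q + L)" "cmod (\<mu> t)" "\<epsilon> / (S + 1)"]
        by (simp add: mult.commute)
      finally show ?thesis by (simp add: m_def)
    qed
    then have "(\<Sum>i<L. cmod (\<mu> (i + (t - L - q))) * cmod (list_seq ys i))
        \<le> (\<Sum>i<L. \<epsilon> / (S + 1) * cmod (list_seq ys i))"
      by (intro sum_mono mult_right_mono) auto
    also have "\<dots> = \<epsilon> / (S + 1) * S"
      by (simp add: S_def sum_distrib_left)
    also have "\<dots> \<le> \<epsilon>"
      using \<epsilon> S by (simp add: field_simps)
    finally show ?thesis .
  qed
  moreover have "t - L \<ge> M" using t(1) by simp
  ultimately show ?thesis unfolding L_def by blast
qed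

text \<open>
  The hypercyclic vector is a concatenation of sparsely placed blocks \<open>Y k\<close>, starting at the
  positions \<open>N k\<close>: shifting block \<open>k\<close> to the origin kills the earlier blocks and leaves the later
  ones with total norm at most \<open>(1/2) ^ k\<close>.
\<close>

lemma ex_block_sequence:
  assumes small: "\<forall>\<epsilon>>0. \<forall>N. \<exists>n\<ge>N. cmod (\<mu> n) < \<epsilon>"
  obtains N X where "\<And>k. l2_bound (\<lambda>m. \<mu> m * (X (m + N k) - list_seq (Y k) m)) ((1/2) ^ k)"
    and "N (0::nat) = (0::nat)"
proof -
  have "\<exists>N. \<forall>k. (k = 0 \<longrightarrow> N k = 0) \<and> (N k + length (Y k) < N (Suc k) \<and> (\<forall>q\<le>N k.
      (\<Sum>i<length (Y (Suc k)). cmod (\<mu> (i + (N (Suc k) - q))) * cmod (list_seq (Y (Suc k)) i))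
        \<le> (1/2) ^ Suc k))"
  \<comment> \<open>The shifts \<open>q\<close> that the next block must tolerate are those up to
    the position just chosen.\<close>
  proof (rule dependent_nat_choice)
    fix n k
    show "\<exists>n'. (Suc k = 0 \<longrightarrow> n' = 0) \<and> (n + length (Y k) < n' \<and> (\<forall>q\<le>n.
      (\<Sum>i<length (Y (Suc k)). cmod (\<mu> (i + (n' - q))) * cmod (list_seq (Y (Suc k)) i))
        \<le> (1/2) ^ Suc k))"
      using ex_small_shift[OF small, of "(1/2) ^ Suc k" "Suc (n + length (Y k))" n "Y (Suc k)"]
      by (simp add: Suc_le_eq)
  qed auto
  then obtain N where N0: "N 0 = 0" and step: "\<And>k. N k + length (Y k) < N (Suc k)"
    and N: "\<And>k q. q \<le> N k \<Longrightarrow>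
      (\<Sum>i<length (Y (Suc k)). cmod (\<mu> (i + (N (Suc k) - q))) * cmod (list_seq (Y (Suc k)) i))
        \<le> (1/2) ^ Suc k"
    by blast
  have N_mono: "N j \<le> N k" if "j \<le> k" for j k
  proof (rule lift_Suc_mono_le[of N, OF _ that])
    show "N n \<le> N (Suc n)" for n using step[of n] by linarith
  qed
  have N_ge: "k \<le> N k" for k
  proof (induction k)
    case (Suc k)
    then show ?case using step[of k] by linarith
  qed simp
  \<comment> \<open>The finite sum is the whole superposition, since block \<open>j\<close> starts
    at \<open>N j \<ge> j\<close> and is zero at \<open>m\<close> when \<open>j > m\<close>.\<close>
  define X where "X m = (\<Sum>j\<le>m. shifted_list_seq (N j) (Y j) m)" for m
  have "l2_bound (\<lambda>m. \<mu> m * (X (m + N k) - list_seq (Y k) m)) ((1/2) ^ k)" for k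
    unfolding l2_bound_def
  proof
    fix M
    define J where "J = {Suc k..<Suc (M + N k)}"
    have X_eq: "X (m + N k) - list_seq (Y k) m =
        (\<Sum>j\<in>J. shifted_list_seq (N j - N k) (Y j) m)" if "m < M" for m
    proof -
      let ?g = "\<lambda>j. shifted_list_seq (N j) (Y j) (m + N k)"
      have late: "?g j = 0" if "j > m + N k" for j
        using N_ge[of j] that by (simp add: shifted_list_seq_def)
      have early: "?g j = 0" if "j < k" for j
        using step[of j] N_mono[of "Suc j" k] that by (simp add: shifted_list_seq_def list_seq_def)
      have k: "k \<le> m + N k" using N_ge[of k] by simp
      have "X (m + N k) = (\<Sum>j\<in>insert k J. ?g j)"
        unfolding X_def
      proof (rule sum.mono_neutral_cong)
        show "?g j = 0" if "j \<in> insert k J - {..m + N k}" for j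
          using that by (intro late) auto
        show "?g j = 0" if "j \<in> {..m + N k} - insert k J" for j
          using that \<open>m < M\<close> by (intro early) (auto simp: J_def)
      qed (auto simp: J_def)
      also have "\<dots> = ?g k + (\<Sum>j\<in>J. ?g j)"
        by (simp add: J_def)
      also have "?g k = list_seq (Y k) m"
        by (simp add: shifted_list_seq_def)
      also have "(\<Sum>j\<in>J. ?g j) = (\<Sum>j\<in>J. shifted_list_seq (N j - N k) (Y j) m)"
      proof (rule sum.cong)
        fix j assume "j \<in> J"
        then have "N k \<le> N j" by (intro N_mono) (simp add: J_def)
        then show "?g j = shifted_list_seq (N j - N k) (Y j) m"
          by (auto simp: shifted_list_seq_def)
      qed simp
      finally show ?thesis by simp
    qed
    have "L2_set (\<lambda>m. cmod (\<mu> m * (X (m + N k) - list_seq (Y k) m))) {..<M} =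
        L2_set (\<lambda>m. cmod (\<Sum>j\<in>J. \<mu> m * shifted_list_seq (N j - N k) (Y j) m)) {..<M}"
      by (intro L2_set_cong) (simp_all add: X_eq sum_distrib_left)
    also have "\<dots> \<le> (\<Sum>j\<in>J. L2_set (\<lambda>m. cmod (\<mu> m * shifted_list_seq (N j - N k) (Y j) m)) {..<M})"
      by (rule L2_set_sum_le)
    also have "\<dots> \<le> (\<Sum>j\<in>J. (1/2) ^ j)"
    proof (rule sum_mono)
      fix j assume "j \<in> J"
      then obtain i where i: "j = Suc i" "k \<le> i" by (cases j) (auto simp: J_def)
      have "L2_set (\<lambda>m. cmod (\<mu> m * shifted_list_seq (N j - N k) (Y j) m)) {..<M}
          \<le> (\<Sum>i<length (Y j). cmod (\<mu> (i + (N j - N k))) * cmod (list_seq (Y j) i))"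
        by (rule l2_bound_D[OF shifted_list_l2_bound])
      also have "\<dots> \<le> (1/2) ^ j"
        \<comment> \<open>The choice of block \<open>Suc i\<close> allowed every shift up to
          \<open>N i\<close>, in particular \<open>N k\<close>.\<close>
        unfolding i(1) by (rule N[OF N_mono[OF i(2)]])
      finally show "L2_set (\<lambda>m. cmod (\<mu> m * shifted_list_seq (N j - N k) (Y j) m)) {..<M}
          \<le> (1/2) ^ j" .
    qed
    also have "\<dots> \<le> (1/2) ^ k"
      unfolding J_def by (rule geometric_half_tail_le)
    finally show "L2_set (\<lambda>m. cmod (\<mu> m * (X (m + N k) - list_seq (Y k) m))) {..<M} \<le> (1/2) ^ k" .
  qed
  with N0 that show thesis by blast
qed

lemma small_\<mu>_imp_hypercyclic:
  assumes small: "\<forall>\<epsilon>>0. \<forall>N. \<exists>n\<ge>N. cmod (\<mu> n) < \<epsilon>"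
  shows "hypercyclic_on H ip T"
proof -
  obtain D :: "complex set" where D: "countable D"
      "\<And>X. open X \<Longrightarrow> X \<noteq> {} \<Longrightarrow> \<exists>d\<in>D. d \<in> X"
    using countable_dense_setE by blast
  define Y where "Y k = from_nat_into (lists D) (fst (prod_decode k))" for k
  obtain N X where X: "\<And>k. l2_bound (\<lambda>m. \<mu> m * (X (m + N k) - list_seq (Y k) m)) ((1/2) ^ k)"
    and N0: "N 0 = 0"
    by (rule ex_block_sequence[OF small, where Y = Y]) blast
  \<comment> \<open>The estimate for block 0, which starts at the origin, shows that
    \<open>X\<close> itself has finite weighted norm.\<close>
  have "l2_bound (\<lambda>m. \<mu> m * (X (m + N 0) - list_seq (Y 0) m) + \<mu> m * list_seq (Y 0) m)
      ((1/2) ^ 0 + (\<Sum>i<length (Y 0). cmod (\<mu> i) * cmod (list_seq (Y 0) i)))"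
    by (intro l2_bound_add X list_l2_bound)
  then have "l2_bound (\<lambda>m. \<mu> m * X m)
      ((1/2) ^ 0 + (\<Sum>i<length (Y 0). cmod (\<mu> i) * cmod (list_seq (Y 0) i)))"
    by (simp add: N0 algebra_simps)
  then obtain f where f: "f \<in> H" "\<And>n. coord f n = X n"
    using ex_coord by blast
  have dense: "\<exists>h\<in>range (\<lambda>n. (T ^^ n) f) \<inter> H. ip_norm ip (g - h) < \<epsilon>"
    if g: "g \<in> H" and \<epsilon>: "\<epsilon> > 0" for g \<epsilon>
  proof -
    obtain ys u where u: "ys \<in> lists D" "u \<in> H" "\<And>n. coord u n = list_seq ys n"
        "ip_norm ip (g - u) < \<epsilon> / 2"
      using lists_dense[OF D(2) g half_gt_zero[OF \<epsilon>]] by blast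
    obtain k0 where k0: "(1/2) ^ k0 < \<epsilon> / 4"
      using real_arch_pow_inv[of "\<epsilon> / 4" "1/2"] \<epsilon> by auto
    have "lists D \<noteq> {}" "countable (lists D)"
      using D(1) lists.Nil by auto
    then obtain i where i: "from_nat_into (lists D) i = ys"
      using from_nat_into_surj u(1) by metis
    define k where "k = prod_encode (i, k0)"
    have "Y k = ys" by (simp add: Y_def k_def i)
    have "(1/2::real) ^ k \<le> (1/2) ^ k0"
      using le_prod_encode_2[of k0 i] by (intro power_decreasing) (auto simp: k_def)
    then have k: "(1/2) ^ k < \<epsilon> / 4" using k0 by (rule order_le_less_trans)
    define h where "h = (T ^^ N k) f"
    have h: "h \<in> H" unfolding h_def by (rule T_power_in[OF f(1)])
    have "coord (h - u) m = X (m + N k) - list_seq (Y k) m" for m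
      unfolding coord_diff[OF h u(2)] u(3) \<open>Y k = ys\<close>
      by (simp add: h_def coord_T_power[OF f(1)] f(2))
    then have "ip_norm ip (h - u) \<le> 2 * (1/2) ^ k"
      using X[of k] by (intro ip_norm_le_coord diff_in h u(2)) (simp only:)
    then have "ip_norm ip (u - h) < \<epsilon> / 2"
      using k ip_norm_diff_sym[OF h u(2)] by linarith
    then have "ip_norm ip (g - h) < \<epsilon>"
      using ip_norm_diff_triangle[OF g u(2) h] u(4) by linarith
    then show ?thesis using h by (intro bexI[of _ h]) (auto simp: h_def)
  qed
  have "mtopology closure_of (range (\<lambda>n. (T ^^ n) f)) = H"
    unfolding closure_eq_H_iff by (intro ballI allI impI dense)
  then show ?thesis
    unfolding hypercyclic_on_def using bounded_T f(1) by (intro conjI bexI)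
qed

section \<open>Topological mixing\<close>

lemma mball_iff: "f \<in> mball g \<epsilon> \<longleftrightarrow> f \<in> H \<and> g \<in> H \<and> ip_norm ip (g - f) < \<epsilon>"
  by (auto simp only: in_mball ip_dist_def if_True simp_thms)

text \<open>A small vector \<open>f\<close> whose \<open>j\<close>-th iterate has first coordinate
  at least 1 in modulus has coordinate \<open>j\<close> that large, so its norm controls
  \<open>\<mu> j\<close>. Mixing supplies such an \<open>f\<close> for every large
  \<open>j\<close>.\<close>

lemma mixing_imp_\<mu>_tendsto_0:
  assumes "topologically_mixing_on H ip T"
  shows "\<mu> \<longlonglongrightarrow> 0"
proof (rule LIMSEQ_I)
  fix \<epsilon> :: real assume \<epsilon>: "\<epsilon> > 0"
  obtain u where u: "u \<in> H" "\<And>g. g \<in> H \<Longrightarrow> ip_norm ip (u - g) < 1 \<Longrightarrow> 1 \<le> cmod (coord g 0)"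
    using ex_ball_large_coord by blast
  define \<delta> where "\<delta> = \<epsilon> * (1 - r)"
  have \<delta>: "\<delta> > 0" using \<epsilon> r by (simp add: \<delta>_def)
  have "u \<in> mball u 1" "0 \<in> mball 0 \<delta>"
    using u(1) \<delta> zero_in by (auto simp: centre_in_mball_iff)
  then have "openin mtopology (mball u 1) \<and> mball u 1 \<noteq> {} \<and>
      openin mtopology (mball 0 \<delta>) \<and> mball 0 \<delta> \<noteq> {}"
    by (metis openin_mball empty_iff)
  then obtain N where N: "\<And>j. j \<ge> N \<Longrightarrow> {f \<in> H. (T ^^ j) f \<in> mball u 1} \<inter> mball 0 \<delta> \<noteq> {}"
    using assms unfolding topologically_mixing_on_def by blast
  have "cmod (\<mu> j) < \<epsilon>" if "j \<ge> N" for j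
  proof -
    obtain f where f: "f \<in> H" "(T ^^ j) f \<in> mball u 1" "f \<in> mball 0 \<delta>"
      using N[OF \<open>j \<ge> N\<close>] by blast
    have "ip_norm ip (0 - f) < \<delta>" using f(3) unfolding mball_iff by (elim conjE)
    then have "ip_norm ip f < \<delta>"
      using ip_norm_diff_sym[OF f(1) zero_in] by (simp only: diff_0_right)
    have "1 \<le> cmod (coord ((T ^^ j) f) 0)"
      using f(2) unfolding mball_iff by (intro u(2)) (elim conjE, assumption)+
    then have "1 \<le> cmod (coord f j)"
      by (simp only: coord_T_power[OF f(1)] add_0)
    then have "cmod (\<mu> j) \<le> cmod (\<mu> j * coord f j)"
      using mult_left_mono[of 1 "cmod (coord f j)" "cmod (\<mu> j)"] by (simp add: norm_mult)
    also have "\<dots> \<le> ip_norm ip f / (1 - r)" by (rule weighted_coord_le[OF f(1)])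
    also have "\<dots> < \<delta> / (1 - r)"
      using \<open>ip_norm ip f < \<delta>\<close> r by (intro divide_strict_right_mono) auto
    also have "\<dots> = \<epsilon>" using r by (simp add: \<delta>_def)
    finally show ?thesis .
  qed
  then show "\<exists>N. \<forall>n\<ge>N. norm (\<mu> n - 0) < \<epsilon>" by auto
qed

text \<open>Take finitely supported \<open>u\<close> in \<open>U\<close> and \<open>v\<close> in
  \<open>V\<close>, and add to \<open>v\<close> a copy of \<open>u\<close> moved up by
  \<open>j\<close>. The copy is small because the weights tend to 0, and the \<open>j\<close>-th
  iterate removes \<open>v\<close> and returns exactly \<open>u\<close>.\<close>

lemma \<mu>_tendsto_0_imp_mixing:
  assumes lim: "\<mu> \<longlonglongrightarrow> 0"
  shows "topologically_mixing_on H ip T"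
  unfolding topologically_mixing_on_def
proof (intro conjI allI impI bounded_T)
  fix U V
  assume UV: "openin mtopology U \<and> U \<noteq> {} \<and> openin mtopology V \<and> V \<noteq> {}"
  have ex_list: "\<exists>ys u. u \<in> H \<and> (\<forall>n. coord u n = list_seq ys n) \<and> u \<in> W"
    if W: "openin mtopology W" "W \<noteq> {}" for W
  proof -
    obtain g where g: "g \<in> W" using W(2) by blast
    then have "g \<in> H" using W(1) unfolding openin_mtopology by blast
    obtain \<epsilon> where \<epsilon>: "\<epsilon> > 0" "mball g \<epsilon> \<subseteq> W"
      using W(1) g unfolding openin_mtopology by blast
    obtain ys u where "u \<in> H" "\<And>n. coord u n = list_seq ys n" "ip_norm ip (g - u) < \<epsilon>"
      by (rule lists_dense[where D = UNIV, OF _ \<open>g \<in> H\<close> \<epsilon>(1)]) auto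
    moreover from this have "u \<in> W" using \<epsilon>(2) \<open>g \<in> H\<close> mball_iff[of u g \<epsilon>] by blast
    ultimately show ?thesis by blast
  qed
  obtain ys u where u: "u \<in> H" "\<And>n. coord u n = list_seq ys n" "u \<in> U"
    using ex_list UV by metis
  obtain zs v where v: "v \<in> H" "\<And>n. coord v n = list_seq zs n" "v \<in> V"
    using ex_list UV by metis
  obtain \<epsilon> where \<epsilon>: "\<epsilon> > 0" "mball v \<epsilon> \<subseteq> V"
    using UV v(3) unfolding openin_mtopology by blast
  define S where "S j = (\<Sum>i<length ys. cmod (\<mu> (i + j)) * cmod (list_seq ys i))" for j
  have "S \<longlonglongrightarrow> (\<Sum>i<length ys. 0 * cmod (list_seq ys i))"
    unfolding S_def
  proof (intro tendsto_sum tendsto_mult tendsto_const)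
    fix i
    have "(\<lambda>j. \<mu> (j + i)) \<longlonglongrightarrow> 0" by (rule LIMSEQ_ignore_initial_segment[OF lim])
    then show "(\<lambda>j. cmod (\<mu> (i + j))) \<longlonglongrightarrow> 0"
      unfolding add.commute[of i] by (rule tendsto_norm_zero)
  qed
  then have "S \<longlonglongrightarrow> 0" by simp
  then have "\<forall>\<^sub>F j in sequentially. S j < \<epsilon> / 2"
    using \<epsilon>(1) by (intro order_tendstoD(2)) auto
  then obtain N where N: "\<And>j. j \<ge> N \<Longrightarrow> S j < \<epsilon> / 2"
    unfolding eventually_sequentially by blast
  \<comment> \<open>\<open>length zs\<close> lets the shift erase \<open>v\<close>; \<open>N\<close>
    keeps the perturbation inside the ball.\<close>
  have "{f \<in> H. (T ^^ j) f \<in> U} \<inter> V \<noteq> {}" if j: "j \<ge> max N (length zs)" for j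
  proof -
    obtain s where s: "s \<in> H" "\<And>n. coord s n = shifted_list_seq j ys n"
      using ex_coord[OF shifted_list_l2_bound] by blast
    have "l2_bound (\<lambda>n. \<mu> n * coord s n) (S j)"
      unfolding s(2) S_def by (rule shifted_list_l2_bound)
    then have "ip_norm ip s \<le> 2 * S j"
      by (rule ip_norm_le_coord[OF s(1)])
    then have "ip_norm ip s < \<epsilon>" using N[of j] j by simp
    define f where "f = v - (- s)"
    have s': "- s \<in> H" using diff_in[OF zero_in s(1)] by (simp only: diff_0)
    have f: "f \<in> H" unfolding f_def by (rule diff_in[OF v(1) s'])
    have "v - f = - s" by (simp add: f_def fun_eq_iff)
    then have "ip_norm ip (v - f) < \<epsilon>"
      using \<open>ip_norm ip s < \<epsilon>\<close> ip_norm_minus[OF s(1)] by (simp only:)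
    then have "f \<in> V" using \<epsilon>(2) mball_iff[of f v \<epsilon>] f v(1) by blast
    have cf: "coord f n = list_seq zs n + shifted_list_seq j ys n" for n
      unfolding f_def diff_minus_eq_add coord_def ip_add[OF v(1) s(1) p_in]
      by (simp only: v(2)[unfolded coord_def] s(2)[unfolded coord_def])
    have "(T ^^ j) f = u"
    proof (rule coord_eqI[OF T_power_in[OF f] u(1)])
      fix n
      show "coord ((T ^^ j) f) n = coord u n"
        using j by (simp add: coord_T_power[OF f] cf u(2) shifted_list_seq_def)
          (simp add: list_seq_def)
    qed
    then show ?thesis using f \<open>f \<in> V\<close> u(3) by blast
  qed
  then show "\<exists>N. \<forall>j\<ge>N. {f \<in> H. (T ^^ j) f \<in> U} \<inter> V \<noteq> {}" by blast
qed

end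

section \<open>Diagonal Taylor coefficients of the kernel\<close>

lemma wirtinger_z_field_differentiable:
  assumes "(f has_field_derivative D) (at z)"
  shows "wirtinger_z f z = D"
proof -
  have "frechet_derivative f (at z) = (*) D"
    by (rule frechet_derivative_at[symmetric]) (use assms in \<open>simp add: has_field_derivative_def\<close>)
  then show ?thesis by (simp add: wirtinger_z_def algebra_simps)
qed

lemma wirtinger_zbar_cnj:
  assumes "(f has_field_derivative D) (at z)"
  shows "wirtinger_zbar (\<lambda>u. cnj (f u)) z = cnj D"
proof -
  have "((\<lambda>u. cnj (f u)) has_derivative (\<lambda>h. cnj (D * h))) (at z)"
    using assms by (intro bounded_linear.has_derivative[OF bounded_linear_cnj]) (simp add: has_field_derivative_def)
  then have "frechet_derivative (\<lambda>u. cnj (f u)) (at z) = (\<lambda>h. cnj (D * h))"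
    by (rule frechet_derivative_at[symmetric])
  then show ?thesis by (simp add: wirtinger_zbar_def algebra_simps)
qed

text \<open>\<open>frechet_derivative\<close> is a choice among all derivatives, and both functions
  have the same derivatives at \<open>z\<close>.\<close>

lemma frechet_derivative_cong_open:
  assumes "open S" "z \<in> S" "\<And>u. u \<in> S \<Longrightarrow> g u = f u"
  shows "frechet_derivative g (at z) = frechet_derivative f (at z)"
proof -
  have "(g has_derivative D) (at z) \<longleftrightarrow> (f has_derivative D) (at z)" for D
    using has_derivative_transform_within_open[of g D z UNIV S f]
      has_derivative_transform_within_open[of f D z UNIV S g] assms by auto
  then show ?thesis by (simp add: frechet_derivative_def)
qed

lemma wirtinger_cong_open:
  assumes "open S" "z \<in> S" "\<And>u. u \<in> S \<Longrightarrow> g u = f u"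
  shows wirtinger_z_cong_open: "wirtinger_z g z = wirtinger_z f z"
    and wirtinger_zbar_cong_open: "wirtinger_zbar g z = wirtinger_zbar f z"
proof -
  have "frechet_derivative g (at z) = frechet_derivative f (at z)"
    using assms by (rule frechet_derivative_cong_open)
  then show "wirtinger_z g z = wirtinger_z f z" "wirtinger_zbar g z = wirtinger_zbar f z"
    by (simp_all only: wirtinger_z_def wirtinger_zbar_def)
qed

text \<open>Equality is carried on all of \<open>S\<close>, not only at one point, because the next
  derivative depends on a neighbourhood.\<close>

lemma funpow_wirtinger_z:
  assumes "open S" "f holomorphic_on S" "\<And>z. z \<in> S \<Longrightarrow> g z = f z" "z \<in> S"
  shows "(wirtinger_z ^^ n) g z = (deriv ^^ n) f z"
  using assms(4)
proof (induction n arbitrary: z)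
  case (Suc n)
  have "(wirtinger_z ^^ Suc n) g z = wirtinger_z ((deriv ^^ n) f) z"
    unfolding funpow.simps comp_apply
    by (rule wirtinger_z_cong_open[OF assms(1) Suc.prems]) (rule Suc.IH)
  also have "\<dots> = deriv ((deriv ^^ n) f) z"
    using assms(1,2) Suc.prems
    by (intro wirtinger_z_field_differentiable holomorphic_derivI[of _ S] holomorphic_higher_deriv)
  finally show ?case by simp
qed (use assms(3) in simp)

lemma funpow_wirtinger_zbar_cnj:
  assumes "open S" "f holomorphic_on S" "\<And>z. z \<in> S \<Longrightarrow> g z = cnj (f z)" "z \<in> S"
  shows "(wirtinger_zbar ^^ n) g z = cnj ((deriv ^^ n) f z)"
  using assms(4)
proof (induction n arbitrary: z)
  case (Suc n)
  have "(wirtinger_zbar ^^ Suc n) g z = wirtinger_zbar (\<lambda>u. cnj ((deriv ^^ n) f u)) z"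
    unfolding funpow.simps comp_apply
    by (rule wirtinger_zbar_cong_open[OF assms(1) Suc.prems]) (rule Suc.IH)
  also have "\<dots> = cnj (deriv ((deriv ^^ n) f) z)"
    using assms(1,2) Suc.prems
    by (intro wirtinger_zbar_cnj holomorphic_derivI[of _ S] holomorphic_higher_deriv)
  finally show ?case by simp
qed (use assms(3) in simp)

lemma higher_deriv_0_eq_coeff:
  fixes f :: "complex \<Rightarrow> complex"
  assumes "\<And>z. z \<in> ball 0 1 \<Longrightarrow> (\<lambda>n. a n * z ^ n) sums f z"
  shows "(deriv ^^ n) f 0 = fact n * a n"
proof -
  have "f has_fps_expansion Abs_fps a"
  proof (rule has_fps_expansionI)
    have "\<forall>\<^sub>F u in nhds (0::complex). u \<in> ball 0 1"
      by (rule eventually_nhds_in_open) auto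
    then show "\<forall>\<^sub>F u in nhds 0. (\<lambda>n. fps_nth (Abs_fps a) n * u ^ n) sums f u"
      by eventually_elim (use assms in simp)
  qed
  from fps_nth_fps_expansion[OF this, of n] show ?thesis
    by (simp add: field_simps)
qed

section \<open>The diagonal kernel coefficients and their size\<close>

context bounded_tridiagonal_space
begin

lemma higher_deriv_0: "f \<in> H \<Longrightarrow> (deriv ^^ n) f 0 = fact n * (pcoeff f n * \<mu> n)"
  by (intro higher_deriv_0_eq_coeff) (auto dest: power_series)

lemma holomorphic: "f \<in> H \<Longrightarrow> f holomorphic_on ball 0 1"
  using analytic by (simp add: analytic_on_open)

abbreviation k where "k \<equiv> tridiag_kernel \<mu> \<nu>"

text \<open>Turns derivatives in the conjugate variable into conjugates of complex derivatives of
  kernel functions, which lie in \<open>H\<close>.\<close>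

lemma kernel_cnj:
  assumes "u \<in> ball 0 1" "w \<in> ball 0 1"
  shows "k u w = cnj (k w u)"
proof -
  have "(\<lambda>n. e n w * cnj (e n u)) sums k w u"
    unfolding tridiag_kernel_def using kernel_summable[OF assms(2,1)] by (rule summable_sums)
  then have "(\<lambda>n. cnj (e n w * cnj (e n u))) sums cnj (k w u)"
    by (simp only: sums_cnj)
  then have "(\<lambda>n. e n u * cnj (e n w)) sums cnj (k w u)"
    by (simp add: mult.commute)
  then show ?thesis
    unfolding tridiag_kernel_def by (simp add: sums_iff)
qed

lemma kernel_in: "u \<in> ball 0 1 \<Longrightarrow> (\<lambda>z. k z u) \<in> H"
  using reproducing_kernel by (simp add: is_reproducing_kernel_def)

lemma ip_kernel_e:
  assumes "u \<in> ball 0 1"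
  shows "ip (\<lambda>z. k z u) (e m) = cnj (e m u)"
proof -
  have "e m u = ip (e m) (\<lambda>z. k z u)"
    using reproducing_kernel assms e_in unfolding is_reproducing_kernel_def by blast
  then show ?thesis using ip_cnj[OF e_in kernel_in[OF assms]] by simp
qed

text \<open>By \<open>\<nu>_eq\<close> this is the sum of the squared moduli of
  \<open>\<mu> n\<close> and \<open>\<nu> (n - 1)\<close>, the latter absent for
  \<open>n = 0\<close>; factoring out the first exposes the comparison with it.\<close>

definition \<kappa> :: "nat \<Rightarrow> real" where
  "\<kappa> n = (cmod (\<mu> n))\<^sup>2 * (1 + case_nat 0 (\<lambda>m. (cmod (\<omega> m))\<^sup>2) n)"

text \<open>The kernel series is never differentiated term by term. The inner derivatives, as a
  function of the first variable, form an element \<open>h\<close> of \<open>H\<close> combining two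
  neighbouring basis functions; the outer derivatives then read off a Taylor coefficient of
  \<open>h\<close>.\<close>

lemma mixed_wirtinger_kernel: "mixed_wirtinger n n k 0 0 = (fact n)\<^sup>2 * of_real (\<kappa> n)"
proof -
  define e' where "e' = (case n of 0 \<Rightarrow> 0 | Suc m \<Rightarrow> cfun_scale (cnj (\<omega> m)) (e m))"
  define h where "h = cfun_scale (fact n * cnj (\<mu> n)) (e n + e')"
  have e': "e' \<in> H"
    unfolding e'_def by (cases n) (simp_all add: zero_in scale_in e_in)
  have h: "h \<in> H"
    unfolding h_def by (intro scale_in add_in e_in e')
  have inner: "(wirtinger_zbar ^^ n) (k u) 0 = h u" if u: "u \<in> ball 0 1" for u
  proof -
    have "(wirtinger_zbar ^^ n) (k u) 0 = cnj ((deriv ^^ n) (\<lambda>w. k w u) 0)"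
    proof (rule funpow_wirtinger_zbar_cnj[of "ball 0 1"])
      show "(\<lambda>w. k w u) holomorphic_on ball 0 1" by (rule holomorphic[OF kernel_in[OF u]])
      show "k u z = cnj (k z u)" if "z \<in> ball 0 1" for z
        using u that by (rule kernel_cnj)
    qed auto
    also have "\<dots> = cnj (fact n * (pcoeff (\<lambda>w. k w u) n * \<mu> n))"
      by (simp only: higher_deriv_0[OF kernel_in[OF u]])
    also have "\<dots> = fact n * cnj (\<mu> n) * (e n u + e' u)"
    proof -
      have "cnj (pcoeff (\<lambda>w. k w u) n) = e n u + e' u"
        unfolding pcoeff_def ip_kernel_e[OF u] e'_def
        by (cases n) (simp_all add: cfun_scale_def)
      then show ?thesis by (simp only: complex_cnj_mult complex_cnj_fact mult_ac)
    qed
    also have "\<dots> = h u"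
      by (simp only: h_def cfun_scale_def plus_fun_apply)
    finally show ?thesis .
  qed
  have ip_h: "ip h (e m) = fact n * cnj (\<mu> n) * (ip (e n) (e m) + ip e' (e m))" for m
    unfolding h_def by (simp only: ip_scale[OF add_in[OF e_in e'] e_in] ip_add[OF e_in e' e_in])
  have ip_e': "ip e' (e m) = (case n of 0 \<Rightarrow> 0 | Suc j \<Rightarrow> cnj (\<omega> j) * (if j = m then 1 else 0))" for m
    unfolding e'_def by (cases n) (simp_all add: ip_zero e_in ip_scale ip_e)
  have "mixed_wirtinger n n k 0 0 = (deriv ^^ n) h 0"
    unfolding mixed_wirtinger_def
    by (rule funpow_wirtinger_z[OF open_ball holomorphic[OF h] inner]) auto
  also have "\<dots> = fact n * (pcoeff h n * \<mu> n)"
    by (rule higher_deriv_0[OF h])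
  also have "pcoeff h n = fact n * cnj (\<mu> n) * of_real (1 + case_nat 0 (\<lambda>m. (cmod (\<omega> m))\<^sup>2) n)"
  proof (cases n)
    case 0
    then show ?thesis by (simp add: pcoeff_def ip_h ip_e' ip_e)
  next
    case (Suc m)
    have "pcoeff h n = fact n * cnj (\<mu> n) * (1 + \<omega> m * cnj (\<omega> m))"
      unfolding pcoeff_def ip_h ip_e' ip_e Suc by (simp add: distrib_left del: fact_Suc)
    then show ?thesis
      unfolding Suc by (simp only: complex_norm_square nat.case of_real_add of_real_1)
  qed
  also have "fact n * cnj (\<mu> n) * of_real (1 + case_nat 0 (\<lambda>m. (cmod (\<omega> m))\<^sup>2) n) * \<mu> n =
      fact n * of_real (\<kappa> n)"
    unfolding \<kappa>_def of_real_mult complex_norm_square by (simp only: mult_ac)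
  finally show ?thesis by (simp add: power2_eq_square mult.assoc)
qed

lemma \<kappa>_ge: "(cmod (\<mu> n))\<^sup>2 \<le> \<kappa> n"
  unfolding \<kappa>_def by (cases n) (simp_all add: algebra_simps)

lemma \<kappa>_nonneg: "0 \<le> \<kappa> n"
  using zero_le_power2 \<kappa>_ge by (rule order_trans)

lemma \<kappa>_le: "\<kappa> n \<le> 2 * (cmod (\<mu> n))\<^sup>2"
proof -
  have "case_nat 0 (\<lambda>m. (cmod (\<omega> m))\<^sup>2) n \<le> 1"
  proof (cases n)
    case (Suc m)
    have "cmod (\<omega> m) \<le> 1" using \<omega>_le[of m] r by linarith
    then show ?thesis using Suc by (simp add: power_le_one)
  qed simp
  then have "(cmod (\<mu> n))\<^sup>2 * (1 + case_nat 0 (\<lambda>m. (cmod (\<omega> m))\<^sup>2) n) \<le> (cmod (\<mu> n))\<^sup>2 * 2"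
    by (intro mult_left_mono) auto
  then show ?thesis by (simp add: \<kappa>_def)
qed

lemma \<kappa>_tendsto_iff: "\<kappa> \<longlonglongrightarrow> 0 \<longleftrightarrow> \<mu> \<longlonglongrightarrow> 0"
proof
  assume "\<kappa> \<longlonglongrightarrow> 0"
  then have "(\<lambda>n. (cmod (\<mu> n))\<^sup>2) \<longlonglongrightarrow> 0"
    by (rule tendsto_sandwich[OF _ _ tendsto_const, rotated -1]) (auto simp: \<kappa>_ge)
  then have "(\<lambda>n. sqrt ((cmod (\<mu> n))\<^sup>2)) \<longlonglongrightarrow> sqrt 0"
    by (rule tendsto_real_sqrt)
  then show "\<mu> \<longlonglongrightarrow> 0" by (simp add: tendsto_norm_zero_iff)
next
  assume "\<mu> \<longlonglongrightarrow> 0"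
  then have "(\<lambda>n. 2 * (cmod (\<mu> n))\<^sup>2) \<longlonglongrightarrow> 2 * (cmod 0)\<^sup>2"
    by (intro tendsto_intros)
  then have lim: "(\<lambda>n. 2 * (cmod (\<mu> n))\<^sup>2) \<longlonglongrightarrow> 0" by simp
  show "\<kappa> \<longlonglongrightarrow> 0"
    by (intro tendsto_sandwich[OF _ _ tendsto_const lim]) (auto simp: \<kappa>_le \<kappa>_nonneg)
qed

lemma liminf_\<kappa>_iff:
  "liminf (\<lambda>n. ereal (\<kappa> n)) = 0 \<longleftrightarrow> (\<forall>\<epsilon>>0. \<forall>N. \<exists>n\<ge>N. cmod (\<mu> n) < \<epsilon>)"
proof
  assume lim: "liminf (\<lambda>n. ereal (\<kappa> n)) = 0"
  show "\<forall>\<epsilon>>0. \<forall>N. \<exists>n\<ge>N. cmod (\<mu> n) < \<epsilon>"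
  proof (intro allI impI, rule ccontr)
    fix \<epsilon> :: real and N
    assume \<epsilon>: "\<epsilon> > 0" and "\<not> (\<exists>n\<ge>N. cmod (\<mu> n) < \<epsilon>)"
    then have "\<epsilon> \<le> cmod (\<mu> n)" if "n \<ge> N" for n
      using that by (meson not_le)
    then have "\<epsilon>\<^sup>2 \<le> (cmod (\<mu> n))\<^sup>2" if "n \<ge> N" for n
      using \<epsilon> that by (intro power_mono) auto
    then have "\<epsilon>\<^sup>2 \<le> \<kappa> n" if "n \<ge> N" for n
      using \<kappa>_ge[of n] that by (meson order_trans)
    then have "\<forall>\<^sub>F n in sequentially. ereal (\<epsilon>\<^sup>2) \<le> ereal (\<kappa> n)"
      unfolding eventually_sequentially by auto
    then have "ereal (\<epsilon>\<^sup>2) \<le> liminf (\<lambda>n. ereal (\<kappa> n))"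
      by (rule Liminf_bounded)
    then show False using lim \<epsilon> by simp
  qed
next
  assume small: "\<forall>\<epsilon>>0. \<forall>N. \<exists>n\<ge>N. cmod (\<mu> n) < \<epsilon>"
  have "0 \<le> liminf (\<lambda>n. ereal (\<kappa> n))"
  proof (rule Liminf_bounded, intro always_eventually allI)
    fix n show "0 \<le> ereal (\<kappa> n)"
      using \<kappa>_nonneg by simp
  qed
  moreover have "liminf (\<lambda>n. ereal (\<kappa> n)) \<le> 0"
  proof (rule ccontr)
    assume "\<not> ?thesis"
    then have "0 < liminf (\<lambda>n. ereal (\<kappa> n))" by (simp only: not_le)
    \<comment> \<open>The lower limit may be infinite, so a real number below it is used
      instead.\<close>
    from ereal_dense2[OF this] obtain y
      where y: "0 < ereal y" "ereal y < liminf (\<lambda>n. ereal (\<kappa> n))" by blast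
    then have "\<forall>\<^sub>F n in sequentially. ereal y < ereal (\<kappa> n)"
      by (intro less_LiminfD)
    then obtain N where N: "\<And>n. n \<ge> N \<Longrightarrow> y < \<kappa> n"
      by (auto simp: eventually_sequentially)
    obtain n where n: "n \<ge> N" "cmod (\<mu> n) < sqrt (y / 2)"
      using small[rule_format, of "sqrt (y / 2)" N] y(1) by auto
    have "(cmod (\<mu> n))\<^sup>2 < (sqrt (y / 2))\<^sup>2"
      using n(2) by (intro power_strict_mono) auto
    then have "2 * (cmod (\<mu> n))\<^sup>2 < y" using y(1) by simp
    then show False using N[OF n(1)] \<kappa>_le[of n] by linarith
  qed
  ultimately show "liminf (\<lambda>n. ereal (\<kappa> n)) = 0" by (rule antisym[rotated])
qed

end

theorem theorem6p1:
  fixes \<mu> \<nu> :: "nat \<Rightarrow> complex"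
    and H :: "(complex \<Rightarrow> complex) set"
    and ip :: "(complex \<Rightarrow> complex) \<Rightarrow> (complex \<Rightarrow> complex) \<Rightarrow> complex"
  assumes "\<And>n. \<mu> n \<noteq> 0" and "\<And>n. \<nu> n \<noteq> 0"
    and "tridiagonal_space \<mu> \<nu> H ip"
    and "(SUP n. ereal (cmod (\<mu> n / \<mu> (Suc n)))) < \<infinity>"
    and "(SUP n. ereal (cmod (\<nu> n / \<mu> (Suc n)))) < 1"
  shows
    "(hypercyclic_on H ip (adjoint_on H ip mult_z) \<longleftrightarrow>
        liminf (\<lambda>n. ereal (Re (1 / (fact n)\<^sup>2 *
          mixed_wirtinger n n (tridiag_kernel \<mu> \<nu>) 0 0))) = 0) \<and>
     (topologically_mixing_on H ip (adjoint_on H ip mult_z) \<longleftrightarrow>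
        (\<lambda>n. 1 / (fact n)\<^sup>2 * mixed_wirtinger n n (tridiag_kernel \<mu> \<nu>) 0 0) \<longlonglongrightarrow> 0)"
proof -
  \<comment> \<open>The real bound is the supremum itself, so strict inequality with 1 passes to
    \<open>r\<close>.\<close>
  have SUP_real: "\<exists>s::real. s \<ge> 0 \<and> ereal s = (SUP n. ereal (cmod (x n))) \<and> (\<forall>n. cmod (x n) \<le> s)"
    if fin: "(SUP n. ereal (cmod (x n))) < \<infinity>" for x :: "nat \<Rightarrow> complex"
  proof -
    have upper: "ereal (cmod (x n)) \<le> (SUP n. ereal (cmod (x n)))" for n
      by (rule SUP_upper) simp
    have "(0::ereal) \<le> ereal (cmod (x 0))" by simp
    then have "0 \<le> (SUP n. ereal (cmod (x n)))"
      using upper[of 0] by (rule order_trans)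
    then obtain s where s: "(SUP n. ereal (cmod (x n))) = ereal s"
      using fin by (cases "SUP n. ereal (cmod (x n))") auto
    with \<open>0 \<le> (SUP n. ereal (cmod (x n)))\<close> upper show ?thesis by (intro exI[of _ s]) simp
  qed
  obtain a where a: "\<And>n. cmod (\<mu> n / \<mu> (Suc n)) \<le> a"
    using SUP_real[OF assms(4)] by blast
  have "(SUP n. ereal (cmod (\<nu> n / \<mu> (Suc n)))) < \<infinity>"
    using assms(5) by (rule order_less_trans) simp
  from SUP_real[OF this] obtain r where r: "r \<ge> 0" "ereal r < 1"
      "\<And>n. cmod (\<nu> n / \<mu> (Suc n)) \<le> r"
    using assms(5) by metis
  interpret tridiagonal_space \<mu> \<nu> H ip by fact
  \<comment> \<open>The maximum ensures that powers of the ratio bound increase with the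
    exponent.\<close>
  interpret bounded_tridiagonal_space \<mu> \<nu> H ip "max a 1" r
  proof
    fix n
    show "\<mu> n \<noteq> 0" by (rule assms(1))
    have pos: "cmod (\<mu> (Suc n)) > 0" using assms(1) by simp
    have "cmod (\<mu> n) \<le> a * cmod (\<mu> (Suc n))"
      using a[of n] pos by (simp add: norm_divide divide_le_eq)
    also have "\<dots> \<le> max a 1 * cmod (\<mu> (Suc n))"
      by (intro mult_right_mono) auto
    finally show "cmod (\<mu> n) \<le> max a 1 * cmod (\<mu> (Suc n))" .
    show "cmod (\<nu> n) \<le> r * cmod (\<mu> (Suc n))"
      using r(3)[of n] pos by (simp add: norm_divide divide_le_eq)
  qed (use r in auto)
  have coeff: "1 / (fact n)\<^sup>2 * mixed_wirtinger n n (tridiag_kernel \<mu> \<nu>) 0 0 = of_real (\<kappa> n)" for n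
    by (simp add: mixed_wirtinger_kernel)
  have "hypercyclic_on H ip (adjoint_on H ip mult_z) \<longleftrightarrow> (\<forall>\<epsilon>>0. \<forall>N. \<exists>n\<ge>N. cmod (\<mu> n) < \<epsilon>)"
    using hypercyclic_imp_small_\<mu> small_\<mu>_imp_hypercyclic by blast
  moreover have "topologically_mixing_on H ip (adjoint_on H ip mult_z) \<longleftrightarrow> \<mu> \<longlonglongrightarrow> 0"
    using mixing_imp_\<mu>_tendsto_0 \<mu>_tendsto_0_imp_mixing by blast
  moreover have "(\<lambda>n. of_real (\<kappa> n) :: complex) \<longlonglongrightarrow> 0 \<longleftrightarrow> \<kappa> \<longlonglongrightarrow> 0"
    using tendsto_of_real_iff[of \<kappa> 0 sequentially, where 'a = complex] by simp
  ultimately show ?thesis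
    unfolding coeff Re_complex_of_real liminf_\<kappa>_iff \<kappa>_tendsto_iff[symmetric] by blast
qed

end
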